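(* Let $T$ be a linear involution on an interval $I$ defined by the data $(\pi,\lambda)$ relative to the alphabet $\mathcal A$, and suppose that $T$ has the Keane property. Let $(\alpha_{\mathrm w_n})_{n\ge0}$ and $(\alpha_{\mathrm l_n})_{n\ge0}$ be the sequences in $\mathcal A\cup\mathcal A^{-1}$ consisting of the (labelled) winners and losers, respectively, of the iterates of the Rauzy--Veech induction algorithm started from $(\pi,\lambda)$. Then $\Omega_T=X_{\boldsymbol\tau_T}$, where the directive sequence $\boldsymbol\tau_T=(\tau_n)_{n\ge0}$ is defined by $$\tau_n(\alpha)=\begin{cases}\alpha_{\mathrm w_n}^{-1}\alpha_{\mathrm l_n} & \text{if }\alpha=\alpha_{\mathrm l_n},\\ \alpha_{\mathrm l_n}^{-1}\alpha_{\mathrm w_n} & \text{if }\alpha=\alpha_{\mathrm l_n}^{-1},\\ \alpha & \text{otherwise.}\end{cases}$$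
   Context: **Generalized permutations.** Let $\mathcal A$ be a finite alphabet of cardinality $d\ge 2$. A generalized permutation of type $(\ell,m)$, with $\ell,m\ge1$, $\ell+m=2d$, is a two-to-one map $\pi\colon\{1,\dots,2d\}\to\mathcal A$, written as a table with top row $\pi(1),\dots,\pi(\ell)$ and bottom row $\pi(\ell+1),\dots,\pi(\ell+m)$. A letter is duplicate if both of its occurrences are in the same row, and simple otherwise. Every generalized permutation is assumed to have duplicate letters in both rows and to be irreducible. Here $\pi$ is reducible if one can choose a prefix and a disjoint suffix of each row (each possibly empty), whose sets of letters (the corners) are respectively $A\cup B$ (top-left), $D\cup B$ (top-right), $A\cup C$ (bottom-left), $D\cup C$ (bottom-right), with $A,B,C,D$ pairwise disjoint, possibly empty, subsets of $\mathcal A$, such that: no corner is empty; or exactly one corner is empty and it is on the left; or exactly two corners are empty and they are on the same side. Otherwise $\pi$ is irreducible. **Linear involutions.** Let $\mathcal A^{-1}$ be a set of formal inverses of the letters, with $(\alpha^{-1})^{-1}=\alpha$. A labelled version $\flat(\pi)\colon\{1,\dots,2d\}\to\mathcal A\cup\mathcal A^{-1}$ of $\pi$ is a bijection obtained by replacing, for each $\alpha\in\mathcal A$, one of the two occurrences of $\alpha$ by $\alpha$ and the other by $\alpha^{-1}$. An admissible length vector for $\pi$ is $\lambda\in\mathbb R_{+}^{\mathcal A}$ (positive entries) with $\sum_{i=1}^{\ell}\lambda_{\pi(i)}=\sum_{i=1}^{m}\lambda_{\pi(\ell+i)}$. Let $I=(0,\sum_{i\le\ell}\lambda_{\pi(i)})$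 and $\tilde I=I\times\{0,1\}$. Partition $I\times\{0\}$ (minus $\ell-1$ points), from left to right, into open intervals $I_{\flat(\pi)(1)},\dots,I_{\flat(\pi)(\ell)}$ of lengths $\lambda_{\pi(1)},\dots,\lambda_{\pi(\ell)}$, and $I\times\{1\}$ (minus $m-1$ points) into $I_{\flat(\pi)(\ell+1)},\dots,I_{\flat(\pi)(\ell+m)}$ of lengths $\lambda_{\pi(\ell+1)},\dots,\lambda_{\pi(\ell+m)}$. Let $\Sigma$ be the set of the $2d-2$ separating points. The linear involution defined by $(\pi,\lambda)$ is $T=\sigma_2\circ\sigma_1$ on $\tilde I\setminus\Sigma$, where $\sigma_1$ is the involution mapping $I_\alpha$ onto $I_{\alpha^{-1}}$ by a translation of the real coordinate if $\alpha$ is simple and by an orientation-reversing isometry if $\alpha$ is duplicate, and $\sigma_2(x,\epsilon)=(x,1-\epsilon)$. **Coding.** $T$ has the Keane property if there is no triple $(x,y,n)$ with $x\in\sigma_2(\Sigma)$, $y\in\Sigma$, $n\ge0$, $T^nx=y$. Let $O$ be the union of the $T$-orbits of the points of $\Sigma$ (wherever defined) and $\tilde O=O\cup\sigma_2(O)$; $T$ is a bijection of $\tilde I\setminus\tilde O$. The natural symbolic coding $(\Omega_T,S)$ is the closure $\Omega_T\subseteq(\mathcal A\cup\mathcal A^{-1})^{\mathbb Z}$ of the set of sequences $(\omega_n)_{n\in\mathbb Z}$ with $\omega_n=\alpha$ iff $T^n(x)\in I_\alpha$, for $x\in\tilde I\setminus\tilde O$, together with the left shift $S$. **Rauzy--Veech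 induction.** Top operation $R_{\mathrm t}$: let $\alpha$ (the winner) be the last letter of the top row and $\beta$ (the loser) the last letter of the bottom row. If the other occurrence of $\alpha$ is in the bottom row, remove $\beta$ from the end of the bottom row and insert it immediately after that other occurrence of $\alpha$. If the other occurrence of $\alpha$ is in the top row and the bottom row contains a duplicate letter which is not the last letter of that row, remove $\beta$ from the end of the bottom row and insert it in the top row immediately before the other occurrence of $\alpha$. Otherwise $R_{\mathrm t}$ is undefined. The bottom operation $R_{\mathrm b}$ is the same with the roles of the rows exchanged. Irreducibility is preserved. For labelled generalized permutations the operations move the labelled letters in the same way (the "other occurrence" of $\alpha\in\mathcal A\cup\mathcal A^{-1}$ being the position of $\alpha^{-1}$), and the labelled winner and loser are the corresponding elements of $\mathcal A\cup\mathcal A^{-1}$ (for a top operation, the winner is $\flat(\pi)(\ell)$ and the loser is $\flat(\pi)(\ell+m)$; for a bottom operation the reverse). If $\lambda_{\pi(\ell)}>\lambda_{\pi(\ell+m)}$ one sets $\mathrm{RV}(\pi,\lambda)=(R_{\mathrm t}(\pi),\lambda')$ with $\lambda'_{\pi(\ell)}=\lambda_{\pi(\ell)}-\lambda_{\pi(\ell+m)}$ and other entries unchanged; if $\lambda_{\pi(\ell+m)}>\lambda_{\pi(\ell)}$ one sets $\mathrm{RV}(\pi,\lambda)=(R_{\mathrm b}(\pi),\lambda')$ with $\lambda'_{\pi(\ell+m)}=\lambda_{\pi(\ell+m)}-\lambda_{\pi(\ell)}$ and other entries unchanged. If $T$ has the Keane property all iterates $\mathrm{RV}^n(\pi,\lambda)$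 are defined; the labels are carried along from $\flat(\pi)$. **$\mathcal S$-adic subshifts.** Let $F_{\mathcal A}$ be the free group on $\mathcal A$, with elements written as reduced words over $\mathcal A\cup\mathcal A^{-1}$. A directive sequence is a sequence $\boldsymbol\tau=(\tau_n)_{n\ge0}$ of morphisms $\tau_n\colon F_{\mathcal A}\to F_{\mathcal A}$. $X_{\boldsymbol\tau}$ is the set of $(x_n)_{n\in\mathbb Z}\in(\mathcal A\cup\mathcal A^{-1})^{\mathbb Z}$ such that for all $k\le l$ the word $x_kx_{k+1}\cdots x_l$ occurs in $\tau_0\circ\tau_1\circ\cdots\circ\tau_{N-1}(\alpha)$ for some $\alpha\in\mathcal A\cup\mathcal A^{-1}$ and $N>0$. *)

theory Defs
  imports "HOL-Analysis.Analysis" "HOL-Algebra.Group" "HOL-Library.Sublist"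
begin

text \<open>
  The alphabet is a type \<open>'a\<close>, taken of class \<open>finite\<close> where this matters; the type
  \<open>'a letter\<close> is the disjoint union of the alphabet and its formal inverses.
\<close>

section \<open>Signed letters\<close>

datatype 'a letter = Pos (base: 'a) | Neg (base: 'a)

primrec inv_letter :: "'a letter \<Rightarrow> 'a letter" where
  "inv_letter (Pos a) = Neg a"
| "inv_letter (Neg a) = Pos a"

lemma inv_letter_inv_letter [simp]: "inv_letter (inv_letter x) = x"
  by (cases x) auto

lemma inv_letter_neq [simp]: "inv_letter x \<noteq> x" "x \<noteq> inv_letter x"
  by (cases x; simp)+

lemma inv_letter_eq_iff: "inv_letter x = y \<longleftrightarrow> x = inv_letter y"
  by auto


section \<open>Generalized permutations\<close>

text \<open>
  A table is the pair of its top and bottom row. The map \<open>\<pi>\<close> on \<open>{1, \<dots>, 2d}\<close> lists the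
  concatenation of the two rows, and \<open>\<ell>\<close>, \<open>m\<close> are the lengths of the rows.
\<close>

type_synonym 'b table = "'b list \<times> 'b list"

text \<open>
  \<open>tl\<close>, \<open>tr\<close>, \<open>bl\<close>, \<open>br\<close> are the words whose sets of letters are the top-left,
  top-right, bottom-left and bottom-right corners.
\<close>

definition reducible :: "'a table \<Rightarrow> bool" where
  "reducible \<pi> \<longleftrightarrow>
    (\<exists>tl tm tr bl bm br A B C D.
       fst \<pi> = tl @ tm @ tr \<and> snd \<pi> = bl @ bm @ br \<and>
       set tl = A \<union> B \<and> set tr = D \<union> B \<and> set bl = A \<union> C \<and> set br = D \<union> C \<and>
       A \<inter> B = {} \<and> A \<inter> C = {} \<and> A \<inter> D = {} \<and> B \<inter> C = {} \<and> B \<inter> D = {} \<and> C \<inter> D = {} \<and>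
       (tl \<noteq> [] \<and> tr \<noteq> [] \<and> bl \<noteq> [] \<and> br \<noteq> []
        \<or> tl = [] \<and> tr \<noteq> [] \<and> bl \<noteq> [] \<and> br \<noteq> []
        \<or> tl \<noteq> [] \<and> tr \<noteq> [] \<and> bl = [] \<and> br \<noteq> []
        \<or> tl = [] \<and> tr \<noteq> [] \<and> bl = [] \<and> br \<noteq> []
        \<or> tl \<noteq> [] \<and> tr = [] \<and> bl \<noteq> [] \<and> br = []))"

definition generalized_permutation :: "'a table \<Rightarrow> bool" where
  "generalized_permutation \<pi> \<longleftrightarrow>
     fst \<pi> \<noteq> [] \<and> snd \<pi> \<noteq> [] \<and>
     (\<forall>a. count_list (fst \<pi> @ snd \<pi>) a = 2) \<and>
     (\<exists>a. count_list (fst \<pi>) a = 2) \<and> (\<exists>a. count_list (snd \<pi>) a = 2) \<and>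
     \<not> reducible \<pi>"

definition labelled_version :: "'a letter table \<Rightarrow> 'a table \<Rightarrow> bool" where
  "labelled_version p \<pi> \<longleftrightarrow>
     map base (fst p) = fst \<pi> \<and> map base (snd p) = snd \<pi> \<and>
     distinct (fst p @ snd p) \<and> set (fst p @ snd p) = UNIV"

definition admissible :: "'a table \<Rightarrow> ('a \<Rightarrow> real) \<Rightarrow> bool" where
  "admissible \<pi> len \<longleftrightarrow>
     (\<forall>a. len a > 0) \<and> (\<Sum>a\<leftarrow>fst \<pi>. len a) = (\<Sum>a\<leftarrow>snd \<pi>. len a)"


section \<open>Linear involutions\<close>

text \<open>
  Throughout, \<open>p\<close> is a labelled table and \<open>len\<close> an admissible length vector. In a point
  \<open>(t, e)\<close>, the level \<open>e\<close> is 0 (top) or 1 (bottom).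
\<close>

type_synonym point = "real \<times> nat"

definition table_row :: "'b table \<Rightarrow> nat \<Rightarrow> 'b list" where
  "table_row p e = (if e = 0 then fst p else snd p)"

definition row_of :: "'b table \<Rightarrow> 'b \<Rightarrow> nat" where
  "row_of p x = (if x \<in> set (fst p) then 0 else 1)"

definition word_len :: "('a \<Rightarrow> real) \<Rightarrow> 'a letter list \<Rightarrow> real" where
  "word_len len w = (\<Sum>x\<leftarrow>w. len (base x))"

definition double_interval :: "'a letter table \<Rightarrow> ('a \<Rightarrow> real) \<Rightarrow> point set" where
  "double_interval p len = {0<..<word_len len (fst p)} \<times> {0, 1}"

definition left_end :: "'a letter table \<Rightarrow> ('a \<Rightarrow> real) \<Rightarrow> 'a letter \<Rightarrow> real" where
  "left_end p len x = word_len len (takeWhile (\<lambda>y. y \<noteq> x) (table_row p (row_of p x)))"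

definition right_end :: "'a letter table \<Rightarrow> ('a \<Rightarrow> real) \<Rightarrow> 'a letter \<Rightarrow> real" where
  "right_end p len x = left_end p len x + len (base x)"

definition piece :: "'a letter table \<Rightarrow> ('a \<Rightarrow> real) \<Rightarrow> 'a letter \<Rightarrow> point set" where
  "piece p len x = {left_end p len x<..<right_end p len x} \<times> {row_of p x}"

definition sing :: "'a letter table \<Rightarrow> ('a \<Rightarrow> real) \<Rightarrow> point set" where
  "sing p len =
     {(word_len len (take i (table_row p e)), e) | i e. e \<in> {0, 1} \<and> 0 < i \<and> i < length (table_row p e)}"

definition simple_letter :: "'b letter table \<Rightarrow> 'b letter \<Rightarrow> bool" where
  "simple_letter p x \<longleftrightarrow> row_of p x \<noteq> row_of p (inv_letter x)"

text \<open>Only the values of \<open>sigma1\<close> on \<open>double_interval p len - sing p len\<close> are meaningful.\<close>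

definition sigma1 :: "'a letter table \<Rightarrow> ('a \<Rightarrow> real) \<Rightarrow> point \<Rightarrow> point" where
  "sigma1 p len z =
     (let x = (THE x. z \<in> piece p len x); y = inv_letter x; s = fst z - left_end p len x
      in (if simple_letter p x then left_end p len y + s else right_end p len y - s,
          row_of p y))"

definition sigma2 :: "point \<Rightarrow> point" where
  "sigma2 z = (fst z, 1 - snd z)"

definition linv :: "'a letter table \<Rightarrow> ('a \<Rightarrow> real) \<Rightarrow> point \<Rightarrow> point" where
  "linv p len = sigma2 \<circ> sigma1 p len"

text \<open>
  The graph of the partial map \<open>T\<close>: \<open>(x, y) \<in> linv_graph p len ^^ n\<close> says that
  \<open>T\<^sup>n x\<close> is defined and equal to \<open>y\<close>.
\<close>

definition linv_graph :: "'a letter table \<Rightarrow> ('a \<Rightarrow> real) \<Rightarrow> (point \<times> point) set" where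
  "linv_graph p len = {(z, linv p len z) | z. z \<in> double_interval p len - sing p len}"

definition keane :: "'a letter table \<Rightarrow> ('a \<Rightarrow> real) \<Rightarrow> bool" where
  "keane p len \<longleftrightarrow>
     \<not> (\<exists>x y n. x \<in> sigma2 ` sing p len \<and> y \<in> sing p len \<and> (x, y) \<in> linv_graph p len ^^ n)"


section \<open>Natural coding\<close>

definition sing_orbits :: "'a letter table \<Rightarrow> ('a \<Rightarrow> real) \<Rightarrow> point set" where
  "sing_orbits p len =
     {y. \<exists>x \<in> sing p len. \<exists>n. (x, y) \<in> linv_graph p len ^^ n \<or> (y, x) \<in> linv_graph p len ^^ n}"

definition regular_points :: "'a letter table \<Rightarrow> ('a \<Rightarrow> real) \<Rightarrow> point set" where
  "regular_points p len = double_interval p len - (sing_orbits p len \<union> sigma2 ` sing_orbits p len)"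

text \<open>\<open>T\<close> is a bijection of \<open>regular_points p len\<close>, whence the negative iterates.\<close>

definition linv_power :: "'a letter table \<Rightarrow> ('a \<Rightarrow> real) \<Rightarrow> int \<Rightarrow> point \<Rightarrow> point" where
  "linv_power p len n =
     (if n \<ge> 0 then linv p len ^^ nat n
      else inv_into (regular_points p len) (linv p len) ^^ nat (- n))"

definition natural_coding :: "'a letter table \<Rightarrow> ('a \<Rightarrow> real) \<Rightarrow> (int \<Rightarrow> 'a letter) set" where
  "natural_coding p len =
     product_topology (\<lambda>_. discrete_topology UNIV) UNIV closure_of
       {\<omega>. \<exists>z \<in> regular_points p len.
            \<forall>n x. \<omega> n = x \<longleftrightarrow> linv_power p len n z \<in> piece p len x}"


section \<open>Rauzy--Veech induction\<close>

fun insert_after :: "'b \<Rightarrow> 'b \<Rightarrow> 'b list \<Rightarrow> 'b list" where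
  "insert_after a b [] = []"
| "insert_after a b (x # xs) = (if x = a then x # b # xs else x # insert_after a b xs)"

fun insert_before :: "'b \<Rightarrow> 'b \<Rightarrow> 'b list \<Rightarrow> 'b list" where
  "insert_before a b [] = []"
| "insert_before a b (x # xs) = (if x = a then b # x # xs else x # insert_before a b xs)"

text \<open>
  The second case requires a pair of inverse letters in the bottom row neither of which is in
  last position. Applying \<open>base\<close> to all entries gives the operations on unlabelled tables.
\<close>

definition rauzy_top :: "'a letter table \<Rightarrow> 'a letter table option" where
  "rauzy_top p =
     (let x = last (fst p); y = last (snd p)
      in if inv_letter x \<in> set (snd p) then
           Some (fst p, insert_after (inv_letter x) y (butlast (snd p)))
         else if \<exists>z. z \<in> set (snd p) \<and> inv_letter z \<in> set (snd p) \<and> base z \<noteq> base y then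
           Some (insert_before (inv_letter x) y (fst p), butlast (snd p))
         else None)"

definition rauzy_bot :: "'a letter table \<Rightarrow> 'a letter table option" where
  "rauzy_bot p = map_option prod.swap (rauzy_top (prod.swap p))"

type_synonym 'a data = "'a letter table \<times> ('a \<Rightarrow> real)"

definition top_wins :: "'a data \<Rightarrow> bool" where
  "top_wins s \<longleftrightarrow> snd s (base (last (fst (fst s)))) > snd s (base (last (snd (fst s))))"

definition bot_wins :: "'a data \<Rightarrow> bool" where
  "bot_wins s \<longleftrightarrow> snd s (base (last (snd (fst s)))) > snd s (base (last (fst (fst s))))"

definition winner :: "'a data \<Rightarrow> 'a letter" where
  "winner s = (if top_wins s then last (fst (fst s)) else last (snd (fst s)))"

definition loser :: "'a data \<Rightarrow> 'a letter" where
  "loser s = (if top_wins s then last (snd (fst s)) else last (fst (fst s)))"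

definition rv :: "'a data \<Rightarrow> 'a data option" where
  "rv s =
     (let p = fst s; len = snd s; a = base (winner s); b = base (loser s);
          len' = len(a := len a - len b)
      in if top_wins s then map_option (\<lambda>q. (q, len')) (rauzy_top p)
         else if bot_wins s then map_option (\<lambda>q. (q, len')) (rauzy_bot p)
         else None)"

text \<open>
  The Keane property implies that all iterates of \<open>rv\<close> are defined, so that \<open>the\<close> below
  is harmless.
\<close>

primrec rv_iter :: "nat \<Rightarrow> 'a data \<Rightarrow> 'a data option" where
  "rv_iter 0 s = Some s"
| "rv_iter (Suc n) s = Option.bind (rv_iter n s) rv"

definition rv_winner :: "'a data \<Rightarrow> nat \<Rightarrow> 'a letter" where
  "rv_winner s n = winner (the (rv_iter n s))"

definition rv_loser :: "'a data \<Rightarrow> nat \<Rightarrow> 'a letter" where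
  "rv_loser s n = loser (the (rv_iter n s))"


section \<open>The free group\<close>

abbreviation reduced :: "'a letter list \<Rightarrow> bool" where
  "reduced \<equiv> successively (\<lambda>x y. y \<noteq> inv_letter x)"

fun cancel_cons :: "'a letter \<Rightarrow> 'a letter list \<Rightarrow> 'a letter list" where
  "cancel_cons x [] = [x]"
| "cancel_cons x (y # w) = (if y = inv_letter x then w else x # y # w)"

definition reduce :: "'a letter list \<Rightarrow> 'a letter list" where
  "reduce w = foldr cancel_cons w []"

definition free_group :: "'a letter list monoid" where
  "free_group =
     \<lparr>carrier = {w. reduced w}, monoid.mult = (\<lambda>u v. reduce (u @ v)), one = []\<rparr>"

text \<open>
  The morphism with prescribed images of the signed letters; the images of inverse letters must
  be inverse to each other.
\<close>

definition morphism_ext :: "('a letter \<Rightarrow> 'a letter list) \<Rightarrow> 'a letter list \<Rightarrow> 'a letter list" where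
  "morphism_ext f w = reduce (concat (map f w))"

lemma reduced_cancel_cons: "reduced w \<Longrightarrow> reduced (cancel_cons x w)"
  by (cases w) (auto simp: successively_Cons)

lemma cancel_cons_inv: "reduced w \<Longrightarrow> cancel_cons x (cancel_cons (inv_letter x) w) = w"
  by (cases w; cases "tl w") (auto simp: successively_Cons)

lemma reduced_foldr: "reduced v \<Longrightarrow> reduced (foldr cancel_cons u v)"
  by (induction u) (auto simp: reduced_cancel_cons)

lemma reduced_reduce: "reduced (reduce w)"
  by (simp add: reduce_def reduced_foldr)

lemma reduce_reduced: "reduced w \<Longrightarrow> reduce w = w"
proof (induction w)
  case (Cons x w)
  then have "reduce w = w" by (auto simp: successively_Cons)
  with Cons.prems show ?case by (cases w) (auto simp: reduce_def)
qed (simp add: reduce_def)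

lemma reduce_append: "reduce (u @ v) = foldr cancel_cons u (reduce v)"
  by (simp add: reduce_def)

lemma foldr_cancel_cons:
  assumes "reduced v"
  shows "foldr cancel_cons (cancel_cons x u) v = cancel_cons x (foldr cancel_cons u v)"
proof (cases u)
  case (Cons y u')
  show ?thesis
    using cancel_cons_inv[OF reduced_foldr[OF assms], of x u'] Cons by auto
qed simp

lemma foldr_reduce: "reduced v \<Longrightarrow> foldr cancel_cons (reduce u) v = foldr cancel_cons u v"
  by (induction u) (auto simp: reduce_def foldr_cancel_cons)

lemma reduce_append_reduce:
  "reduce (reduce u @ v) = reduce (u @ v)" "reduce (u @ reduce v) = reduce (u @ v)"
  by (simp_all add: reduce_append foldr_reduce reduced_reduce reduce_reduced)

lemma reduce_inverse: "reduce (rev (map inv_letter w) @ w) = []"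
proof (induction w)
  case (Cons x w)
  have "cancel_cons (inv_letter x) (cancel_cons x (reduce w)) = reduce w"
    using cancel_cons_inv[OF reduced_reduce, of "inv_letter x"] by simp
  then show ?case using Cons by (simp add: reduce_def)
qed (simp add: reduce_def)

lemma reduced_inverse: "reduced w \<Longrightarrow> reduced (rev (map inv_letter w))"
  by (auto simp: successively_map inv_letter_eq_iff elim!: successively_mono)

lemma group_free_group: "group free_group"
proof (rule groupI)
  fix u :: "'a letter list"
  assume "u \<in> carrier free_group"
  then show "\<exists>v \<in> carrier free_group. v \<otimes>\<^bsub>free_group\<^esub> u = \<one>\<^bsub>free_group\<^esub>"
    using reduce_inverse reduced_inverse by (fastforce simp: free_group_def)
qed (auto simp: free_group_def reduced_reduce reduce_reduced reduce_append_reduce)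

lemma morphism_ext_hom:
  assumes "\<And>x. reduce (f x @ f (inv_letter x)) = []"
  shows "morphism_ext f \<in> hom free_group free_group"
proof -
  have *: "reduce (concat (map f (cancel_cons x w))) = reduce (f x @ concat (map f w))" for x w
  proof (cases w)
    case (Cons y v)
    have "reduce (f x @ f (inv_letter x) @ concat (map f v)) = reduce (concat (map f v))"
      using reduce_append_reduce(1)[of "f x @ f (inv_letter x)" "concat (map f v)"]
      by (simp add: assms)
    then show ?thesis using Cons by auto
  qed simp
  have "reduce (concat (map f (reduce w))) = reduce (concat (map f w))" for w
  proof (induction w)
    case (Cons x w)
    have "reduce (concat (map f (reduce (x # w)))) = reduce (f x @ concat (map f (reduce w)))"
      using * by (simp add: reduce_def)
    also have "\<dots> = reduce (f x @ concat (map f w))"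
      by (metis Cons reduce_append_reduce(2))
    finally show ?case by simp
  qed (simp add: reduce_def)
  then show ?thesis
    by (auto simp: hom_def free_group_def morphism_ext_def reduced_reduce reduce_append_reduce)
qed


section \<open>S-adic subshifts\<close>

primrec compose_upto :: "(nat \<Rightarrow> 'b \<Rightarrow> 'b) \<Rightarrow> nat \<Rightarrow> 'b \<Rightarrow> 'b" where
  "compose_upto \<tau> 0 = id"
| "compose_upto \<tau> (Suc n) = compose_upto \<tau> n \<circ> \<tau> n"

definition sadic_subshift ::
    "(nat \<Rightarrow> 'a letter list \<Rightarrow> 'a letter list) \<Rightarrow> (int \<Rightarrow> 'a letter) set" where
  "sadic_subshift \<tau> =
     {\<omega>. \<forall>k l. k \<le> l \<longrightarrow> (\<exists>x N. N > 0 \<and> sublist (map \<omega> [k..l]) (compose_upto \<tau> N [x]))}"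

definition rv_morphism ::
    "'a letter \<Rightarrow> 'a letter \<Rightarrow> 'a letter list \<Rightarrow> 'a letter list" where
  "rv_morphism w l = morphism_ext
     (\<lambda>x. if x = l then [inv_letter w, l]
          else if x = inv_letter l then [inv_letter l, w]
          else [x])"

lemma rv_morphism_hom: "rv_morphism w l \<in> hom free_group free_group"
  unfolding rv_morphism_def
  by (rule morphism_ext_hom) (auto simp: reduce_def inv_letter_eq_iff)

lemma rv_morphism_letter:
  assumes "w \<noteq> l"
  shows "rv_morphism w l [x] =
    (if x = l then [inv_letter w, l] else if x = inv_letter l then [inv_letter l, w] else [x])"
  using assms by (auto simp: rv_morphism_def morphism_ext_def reduce_def inv_letter_eq_iff)

definition rv_directive_sequence ::
    "'a data \<Rightarrow> nat \<Rightarrow> 'a letter list \<Rightarrow> 'a letter list" where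
  "rv_directive_sequence s n = rv_morphism (rv_winner s n) (rv_loser s n)"

end

theory Submission
  imports Defs
begin

text \<open>
  One step of the Rauzy--Veech induction replaces the linear involution \<open>T\<close> on the double interval
  by the linear involution \<open>T'\<close> that it induces on a shorter double interval. Only the pieces of
  the loser \<open>l\<close> and of its inverse need more than one application of \<open>T\<close> to return: the new piece
  \<open>l\<close> is contained in the old piece \<open>w\<^sup>-\<^sup>1\<close> (\<open>w\<close> being the winner) and is mapped by \<open>T\<close> into the
  old piece \<open>l\<close>, and the piece \<open>l\<^sup>-\<^sup>1\<close> is mapped by \<open>T\<close> into the old piece \<open>w\<close> (\<open>induced_loser\<close>,
  \<open>induced_loser_inverse\<close>, \<open>induced_other\<close>). Hence the morphism \<open>\<tau>\<^sub>n\<close> sends the coding of a finite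
  orbit segment of the \<open>(n + 1)\<close>-st involution to the coding of the same segment for the \<open>n\<close>-th one.
  A word that codes an orbit segment is reduced, because \<open>T\<close> takes the piece \<open>x\<close> to the level opposite
  to that of \<open>x\<^sup>-\<^sup>1\<close>; so no cancellation occurs in the free group, and \<open>\<tau>\<^sub>0 \<dots> \<tau>\<^sub>N\<^sub>-\<^sub>1(x)\<close> is
  the word read along an orbit of \<open>T\<close> from the piece \<open>x\<close> of the \<open>N\<close>-th involution until the return
  to the \<open>N\<close>-th double interval (\<open>codes_compose\<close>).

  Consequently every factor of such a word occurs in the itinerary of a regular point: each piece
  contains regular points, since the excluded orbits are countable. This gives one inclusion
  (\<open>sadic_word_in_itinerary\<close>). Conversely, the orbit of a regular point is a concatenation of
  returns to the \<open>N\<close>-th double interval. If that interval is so short that it contains no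
  point of a given finite orbit segment, then the segment lies inside one return, and its coding is
  a factor of \<open>\<tau>\<^sub>0 \<dots> \<tau>\<^sub>N\<^sub>-\<^sub>1(x)\<close> for some \<open>x\<close> (\<open>coding_in_return_word\<close>).

  It remains to show that the lengths of the intervals tend to \<open>0\<close> (\<open>widths_tendsto_0\<close>).
  In each step the interval gets shorter by the length of the loser, so the lengths of the losers tend
  to \<open>0\<close>, and a letter that loses infinitely often has length tending to \<open>0\<close>. Losing infinitely often is equivalent
  to winning infinitely often. If some letter did neither, then a monotone counting argument shows
  that eventually both rows start with blocks made of all occurrences of such letters.
  These blocks and their lengths do not change any more, and what follows them has length tending to
  \<open>0\<close>; so both blocks have the same length, and their common right end point is a
  separating point of both rows, against the Keane property. The Keane property itself passes to
  the induced involution (\<open>new_keane\<close>) because the new separating points lie on \<open>T\<close>-orbits of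
  the old ones.
\<close>

section \<open>Lengths of words and the geometry of the pieces\<close>

lemma word_len_simps [simp]:
  "word_len f [] = 0" "word_len f (x # u) = f (base x) + word_len f u"
  "word_len f (u @ v) = word_len f u + word_len f v"
  by (simp_all add: word_len_def)

lemma word_len_nonneg: "(\<And>a. f a > 0) \<Longrightarrow> 0 \<le> word_len f u"
  by (induction u) (auto intro: add_nonneg_nonneg less_imp_le)

lemma word_len_pos: "(\<And>a. f a > 0) \<Longrightarrow> u \<noteq> [] \<Longrightarrow> 0 < word_len f u"
  by (cases u) (auto intro: add_pos_nonneg word_len_nonneg)

lemma word_len_cong:
  "(\<And>x. x \<in> set u \<Longrightarrow> f (base x) = g (base x)) \<Longrightarrow> word_len f u = word_len g u"
  by (induction u) auto

text \<open>
  The intervals of a row tile the interval of its total length; left end points are included here so that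
  the tiling has no gaps.
\<close>

lemma ex_letter_at:
  assumes "0 \<le> t" "t < word_len f u"
  shows "\<exists>us x vs. u = us @ x # vs \<and> word_len f us \<le> t \<and> t < word_len f us + f (base x)"
  using assms
proof (induction u arbitrary: t)
  case (Cons y u)
  show ?case
  proof (cases "t < f (base y)")
    case True
    then show ?thesis using Cons.prems by (intro exI[of _ "[]"]) auto
  next
    case False
    then obtain us x vs where
      "u = us @ x # vs" "word_len f us \<le> t - f (base y)" "t - f (base y) < word_len f us + f (base x)"
      using Cons.IH[of "t - f (base y)"] Cons.prems by auto
    then show ?thesis by (intro exI[of _ "y # us"]) auto
  qed
qed simp

lemma base_inv_letter [simp]: "base (inv_letter x) = base x"
  by (cases x) auto

lemma base_eq_iff: "base x = base y \<longleftrightarrow> x = y \<or> x = inv_letter y"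
  by (cases x; cases y) auto

lemma inv_letter_eq_cancel [simp]: "inv_letter x = inv_letter y \<longleftrightarrow> x = y"
  by (metis inv_letter_inv_letter)

lemma sigma2_sigma2 [simp]: "snd z \<in> {0, 1} \<Longrightarrow> sigma2 (sigma2 z) = z"
  by (cases z) (auto simp: sigma2_def)

text \<open>
  Stated for the labelled table alone, so that it applies to every table met along the induction.
\<close>

locale linear_involution =
  fixes p :: "'a letter table" and len :: "'a \<Rightarrow> real"
  assumes distinct_letters: "distinct (fst p @ snd p)"
    and all_letters: "set (fst p @ snd p) = UNIV"
    and len_pos: "len a > 0"
    and balanced: "word_len len (fst p) = word_len len (snd p)"
begin

text \<open>
  For a letter \<open>x\<close>, the piece \<open>J x\<close> is the open interval of length \<open>len (base x)\<close> with left
  end point \<open>L x\<close> on the level \<open>lev x\<close>.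
\<close>

abbreviation "T \<equiv> linv p len"
abbreviation "L \<equiv> left_end p len"
abbreviation "lev \<equiv> row_of p"
abbreviation "J \<equiv> piece p len"
abbreviation "R \<equiv> regular_points p len"
abbreviation "G \<equiv> linv_graph p len"
abbreviation "width \<equiv> word_len len (fst p)"

lemma len_nonneg: "0 \<le> len a"
  using len_pos[of a] by simp

lemma row_cases: "lev x = 0 \<or> lev x = 1"
  by (simp add: row_of_def)

lemma mem_row: "e = 0 \<or> e = 1 \<Longrightarrow> x \<in> set (table_row p e) \<longleftrightarrow> lev x = e"
  using distinct_letters all_letters UNIV_I[of x] by (auto simp: table_row_def row_of_def)

lemma distinct_row: "distinct (table_row p e)"
  using distinct_letters by (auto simp: table_row_def)

lemma word_len_row: "word_len len (table_row p e) = width"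
  using balanced by (simp add: table_row_def)

lemma left_end_eq:
  assumes "e = 0 \<or> e = 1" "table_row p e = us @ x # vs"
  shows "lev x = e" "L x = word_len len us"
proof -
  show *: "lev x = e" using mem_row[of e x] assms by auto
  have "x \<notin> set us" using distinct_row[of e] assms by auto
  then have "takeWhile (\<lambda>y. y \<noteq> x) (us @ x # vs) = us"
    by (auto simp: takeWhile_append)
  then show "L x = word_len len us" using * assms by (simp add: left_end_def)
qed

lemma row_split:
  obtains us vs where "table_row p (lev x) = us @ x # vs" "L x = word_len len us"
proof -
  have "x \<in> set (table_row p (lev x))" using mem_row[of "lev x" x] row_cases[of x] by auto
  then obtain us vs where *: "table_row p (lev x) = us @ x # vs" by (meson split_list)
  with left_end_eq[OF row_cases *] that show ?thesis by auto
qed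

lemma left_nonneg: "0 \<le> L x"
  using row_split[of x] word_len_nonneg[of len] len_pos by metis

lemma right_le_width: "L x + len (base x) \<le> width"
proof -
  obtain us vs where *: "table_row p (lev x) = us @ x # vs" "L x = word_len len us"
    by (rule row_split)
  then have "width = word_len len us + (len (base x) + word_len len vs)"
    using word_len_row[of "lev x"] by simp
  then show ?thesis using *(2) word_len_nonneg[of len vs] len_pos by auto
qed

lemma pieces_separated:
  assumes "lev x = lev y" "x \<noteq> y"
  shows "L y + len (base y) \<le> L x \<or> L x + len (base x) \<le> L y"
proof -
  obtain us vs where x: "table_row p (lev x) = us @ x # vs" "L x = word_len len us"
    by (rule row_split)
  have "y \<in> set (us @ x # vs)" using mem_row[of "lev x" y] row_cases[of x] assms x by auto
  then consider "y \<in> set us" | "y \<in> set vs" using assms by auto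
  then show ?thesis
  proof cases
    case 1
    then obtain u1 u2 where u: "us = u1 @ y # u2" by (meson split_list)
    then have "L y = word_len len u1"
      using left_end_eq[of "lev x" u1 y] x row_cases[of x] by simp
    then show ?thesis using u x word_len_nonneg[of len u2] len_pos by auto
  next
    case 2
    then obtain u1 u2 where u: "vs = u1 @ y # u2" by (meson split_list)
    then have "L y = word_len len (us @ x # u1)"
      using left_end_eq[of "lev x" "us @ x # u1" y] x row_cases[of x] by simp
    then show ?thesis using u x word_len_nonneg[of len u1] len_pos by auto
  qed
qed

lemma mem_piece: "z \<in> J x \<longleftrightarrow> L x < fst z \<and> fst z < L x + len (base x) \<and> snd z = lev x"
  by (cases z) (auto simp: piece_def right_end_def)

lemma piece_unique: "z \<in> J x \<Longrightarrow> z \<in> J y \<Longrightarrow> x = y"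
  using pieces_separated[of x y] by (force simp: mem_piece)

text \<open>
  The separating points are exactly the left end points of the pieces that do not come first in
  their row. In this form they can be followed through an induction step letter by letter.
\<close>

lemma mem_sing: "z \<in> sing p len \<longleftrightarrow> (\<exists>x. z = (L x, lev x) \<and> L x > 0)"
proof
  assume "z \<in> sing p len"
  then obtain i e where z: "z = (word_len len (take i (table_row p e)), e)" "e = 0 \<or> e = 1"
    "0 < i" "i < length (table_row p e)" by (auto simp: sing_def)
  let ?x = "table_row p e ! i"
  have "table_row p e = take i (table_row p e) @ ?x # drop (Suc i) (table_row p e)"
    using z by (simp add: id_take_nth_drop)
  from left_end_eq[OF z(2) this] have "lev ?x = e" "L ?x = word_len len (take i (table_row p e))"
    by auto
  moreover have "take i (table_row p e) \<noteq> []" using z by auto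
  then have "word_len len (take i (table_row p e)) > 0"
    using word_len_pos len_pos by blast
  ultimately show "\<exists>x. z = (L x, lev x) \<and> L x > 0" using z by (intro exI[of _ ?x]) auto
next
  assume "\<exists>x. z = (L x, lev x) \<and> L x > 0"
  then obtain x where z: "z = (L x, lev x)" "L x > 0" by auto
  obtain us vs where x: "table_row p (lev x) = us @ x # vs" "L x = word_len len us"
    by (rule row_split)
  then have "length us > 0" "word_len len us = word_len len (take (length us) (table_row p (lev x)))"
    "length us < length (table_row p (lev x))" using z by auto
  then show "z \<in> sing p len" using z x row_cases[of x]
    unfolding sing_def by (intro CollectI exI[of _ "length us"] exI[of _ "lev x"]) simp
qed

lemma mem_double_interval:
  "z \<in> double_interval p len \<longleftrightarrow> 0 < fst z \<and> fst z < width \<and> (snd z = 0 \<or> snd z = 1)"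
  by (cases z) (auto simp: double_interval_def)

lemma letter_at:
  assumes "0 \<le> t" "t < width" "e = 0 \<or> e = 1"
  obtains x where "lev x = e" "L x \<le> t" "t < L x + len (base x)"
proof -
  obtain us x vs where "table_row p e = us @ x # vs" "word_len len us \<le> t"
      "t < word_len len us + len (base x)"
    using ex_letter_at[of t len "table_row p e"] assms by (auto simp: word_len_row)
  with left_end_eq[OF assms(3)] that show ?thesis by metis
qed

lemma domain_eq: "double_interval p len - sing p len = (\<Union>x. J x)"
proof (rule equalityI; rule subsetI)
  fix z assume z: "z \<in> double_interval p len - sing p len"
  then obtain x where x: "lev x = snd z" "L x \<le> fst z" "fst z < L x + len (base x)"
    using letter_at[of "fst z" "snd z"] by (auto simp: mem_double_interval)
  have "L x \<noteq> fst z"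
  proof
    assume "L x = fst z"
    then have "z = (L x, lev x)" "L x > 0" using x z by (simp_all add: mem_double_interval)
    then show False using z by (auto simp: mem_sing)
  qed
  then have "z \<in> J x" using x by (simp add: mem_piece)
  then show "z \<in> (\<Union>x. J x)" by blast
next
  fix z assume "z \<in> (\<Union>x. J x)"
  then obtain x where x: "z \<in> J x" by auto
  have "z \<notin> sing p len"
  proof
    assume "z \<in> sing p len"
    then obtain y where y: "z = (L y, lev y)" by (auto simp: mem_sing)
    then show False using x pieces_separated[of x y] len_pos[of "base y"]
      by (cases "x = y") (auto simp: mem_piece)
  qed
  then show "z \<in> double_interval p len - sing p len"
    using x left_nonneg[of x] right_le_width[of x] row_cases[of x]
    by (auto simp: mem_piece mem_double_interval)
qed

lemma graph_iff: "(z, y) \<in> G \<longleftrightarrow> (\<exists>x. z \<in> J x) \<and> y = T z"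
  unfolding linv_graph_def domain_eq by (cases z) auto

lemma sigma1_eq:
  assumes "z \<in> J x"
  shows "sigma1 p len z =
    (if lev x \<noteq> lev (inv_letter x) then L (inv_letter x) + (fst z - L x)
     else L (inv_letter x) + len (base x) - (fst z - L x), lev (inv_letter x))"
proof -
  have "(THE x. z \<in> J x) = x" using assms piece_unique by blast
  then show ?thesis by (simp add: sigma1_def simple_letter_def right_end_def Let_def)
qed

lemma sigma1_piece: "z \<in> J x \<Longrightarrow> sigma1 p len z \<in> J (inv_letter x)"
  by (subst sigma1_eq) (auto simp: mem_piece)

lemma sigma1_sigma1:
  assumes "z \<in> J x" shows "sigma1 p len (sigma1 p len z) = z"
  using assms by (subst sigma1_eq[OF sigma1_piece[OF assms]])
    (auto simp: sigma1_eq mem_piece prod_eq_iff)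

lemma linv_eq:
  assumes "z \<in> J x"
  shows "T z =
    (if lev x \<noteq> lev (inv_letter x) then L (inv_letter x) + (fst z - L x)
     else L (inv_letter x) + len (base x) - (fst z - L x), 1 - lev (inv_letter x))"
  by (simp add: linv_def sigma1_eq[OF assms] sigma2_def)

lemma sigma2_linv: "z \<in> J x \<Longrightarrow> sigma2 (T z) \<in> J (inv_letter x)"
  using sigma1_piece[of z x] row_cases[of "inv_letter x"] by (auto simp: linv_def mem_piece)

text \<open>
  Since \<open>T\<close> is a product of two involutions, \<open>\<sigma>\<^sub>2\<close> conjugates it to its inverse. This is how
  preimages under \<open>T\<close> are obtained everywhere below.
\<close>

lemma linv_reverse:
  assumes "z \<in> J x" shows "T (sigma2 (T z)) = sigma2 z"
proof -
  have "sigma2 (T z) = sigma1 p len z"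
    using sigma1_piece[OF assms] row_cases[of "inv_letter x"] by (auto simp: linv_def mem_piece)
  then show ?thesis by (simp add: linv_def sigma1_sigma1[OF assms])
qed

lemma linv_inj:
  assumes "z \<in> J x" "z' \<in> J x'" "T z = T z'" shows "z = z'"
proof -
  have "sigma2 (sigma2 z) = sigma2 (sigma2 z')" using linv_reverse assms by metis
  moreover have "snd z \<in> {0,1}" "snd z' \<in> {0,1}"
    using assms row_cases by (auto simp: mem_piece)
  ultimately show ?thesis by simp
qed

lemma sigma2_interval: "z \<in> double_interval p len \<Longrightarrow> sigma2 z \<in> double_interval p len"
  by (auto simp: mem_double_interval sigma2_def)

lemma sing_interval: "sing p len \<subseteq> double_interval p len"
proof
  fix z assume "z \<in> sing p len"
  then obtain x where "z = (L x, lev x)" "L x > 0" by (auto simp: mem_sing)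
  then show "z \<in> double_interval p len"
    using right_le_width[of x] len_pos[of "base x"] row_cases[of x]
    by (auto simp: mem_double_interval)
qed

lemma piece_interval: "z \<in> J x \<Longrightarrow> z \<in> double_interval p len"
  using domain_eq by blast

lemma linv_interval: "z \<in> J x \<Longrightarrow> T z \<in> double_interval p len"
  using piece_interval[OF sigma2_linv, of z x] row_cases[of "inv_letter x"]
  by (auto simp: linv_eq mem_double_interval sigma2_def)

section \<open>Regular points\<close>

abbreviation "orb \<equiv> sing_orbits p len"

lemma graph_inj:
  assumes "(y, x) \<in> G" "(y', x) \<in> G" shows "y = y'"
proof -
  obtain a a' where "y \<in> J a" "y' \<in> J a'" "x = T y" "x = T y'"
    using assms unfolding graph_iff by (elim conjE exE)
  then show ?thesis using linv_inj[of y a y' a'] by simp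
qed

lemma sing_orbitsI: "x \<in> sing p len \<Longrightarrow> x \<in> orb"
  unfolding sing_orbits_def by (rule CollectI, rule bexI[of _ x], rule exI[of _ 0]) auto

text \<open>
  For the forward direction of the orbit this uses that \<open>T\<close> is injective, so that \<open>z\<close> precedes \<open>y\<close> on every orbit
  through \<open>y\<close>.
\<close>

lemma sing_orbits_graph:
  assumes "(z, y) \<in> G" shows "y \<in> orb \<longleftrightarrow> z \<in> orb"
proof
  assume "y \<in> orb"
  then obtain x n where x: "x \<in> sing p len" "(x, y) \<in> G ^^ n \<or> (y, x) \<in> G ^^ n"
    by (auto simp: sing_orbits_def)
  have "\<exists>n. (x, z) \<in> G ^^ n \<or> (z, x) \<in> G ^^ n"
  proof (cases "(x, y) \<in> G ^^ n")
    case True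
    show ?thesis
    proof (cases n)
      case 0
      then have "(z, x) \<in> G ^^ 1" using True assms by auto
      then show ?thesis by blast
    next
      case (Suc k)
      then obtain y0 where "(x, y0) \<in> G ^^ k" "(y0, y) \<in> G" using True by auto
      then show ?thesis using graph_inj[OF assms] by blast
    qed
  next
    case False
    then have "(z, x) \<in> G ^^ Suc n" using x(2) relpow_Suc_I2[OF assms] by simp
    then show ?thesis by blast
  qed
  then show "z \<in> orb" using x by (auto simp: sing_orbits_def)
next
  assume "z \<in> orb"
  then obtain x n where x: "x \<in> sing p len" "(x, z) \<in> G ^^ n \<or> (z, x) \<in> G ^^ n"
    by (auto simp: sing_orbits_def)
  have "\<exists>n. (x, y) \<in> G ^^ n \<or> (y, x) \<in> G ^^ n"
  proof (cases "(x, z) \<in> G ^^ n")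
    case True
    then have "(x, y) \<in> G ^^ Suc n" using assms by auto
    then show ?thesis by blast
  next
    case False
    then have zx: "(z, x) \<in> G ^^ n" using x by auto
    show ?thesis
    proof (cases n)
      case 0
      then show ?thesis using False zx by auto
    next
      case (Suc k)
      then obtain y0 where "(z, y0) \<in> G" "(y0, x) \<in> G ^^ k" using zx by (meson relpow_Suc_E2)
      then show ?thesis using assms by (auto simp: graph_iff)
    qed
  qed
  then show "y \<in> orb" using x by (auto simp: sing_orbits_def)
qed

lemma sing_orbits_pow: "(z, y) \<in> G ^^ n \<Longrightarrow> y \<in> orb \<longleftrightarrow> z \<in> orb"
proof (induction n arbitrary: y)
  case (Suc n)
  from Suc.prems obtain u where "(z, u) \<in> G ^^ n" "(u, y) \<in> G" by (rule relpow_Suc_E)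
  then show ?case using sing_orbits_graph[of u y] Suc.IH[of u] by simp
qed simp

lemma sing_orbits_interval: "orb \<subseteq> double_interval p len"
proof
  fix y assume "y \<in> orb"
  then obtain x n where x: "x \<in> sing p len" "(x, y) \<in> G ^^ n \<or> (y, x) \<in> G ^^ n"
    by (auto simp: sing_orbits_def)
  show "y \<in> double_interval p len"
  proof (cases n)
    case 0
    then show ?thesis using x sing_interval by auto
  next
    case (Suc k)
    from x(2) show ?thesis
    proof
      assume "(x, y) \<in> G ^^ n"
      then obtain y0 where "(y0, y) \<in> G" using Suc by auto
      then show ?thesis unfolding graph_iff using linv_interval by blast
    next
      assume "(y, x) \<in> G ^^ n"
      then obtain y0 where "(y, y0) \<in> G" using Suc by (meson relpow_Suc_E2)
      then show ?thesis unfolding graph_iff using piece_interval by blast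
    qed
  qed
qed

lemma sigma2_image_iff:
  assumes "snd z = 0 \<or> snd z = 1" "A \<subseteq> double_interval p len"
  shows "z \<in> sigma2 ` A \<longleftrightarrow> sigma2 z \<in> A"
proof
  assume "z \<in> sigma2 ` A"
  then obtain y where "y \<in> A" "z = sigma2 y" by auto
  then show "sigma2 z \<in> A" using assms sigma2_sigma2[of y] by (auto simp: mem_double_interval)
next
  assume "sigma2 z \<in> A"
  then have "sigma2 (sigma2 z) \<in> sigma2 ` A" by blast
  then show "z \<in> sigma2 ` A" using assms sigma2_sigma2[of z] by auto
qed

lemma regular_iff: "z \<in> R \<longleftrightarrow> z \<in> double_interval p len \<and> z \<notin> orb \<and> sigma2 z \<notin> orb"
  using sigma2_image_iff[OF _ sing_orbits_interval, of z]
  by (auto simp: regular_points_def mem_double_interval)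

lemma regular_piece: "z \<in> R \<Longrightarrow> \<exists>x. z \<in> J x"
  using domain_eq sing_orbitsI[of z] unfolding regular_iff by (metis DiffI UN_E)

lemma regular_sigma2: "z \<in> R \<Longrightarrow> sigma2 z \<in> R"
  using sigma2_sigma2[of z] sigma2_interval[of z] by (simp add: regular_iff mem_double_interval)

text \<open>
  The condition on \<open>\<sigma>\<^sub>2\<close> in the definition of regularity is preserved because \<open>\<sigma>\<^sub>2\<close> reverses orbits.
\<close>

lemma regular_linv:
  assumes "z \<in> R" shows "T z \<in> R"
proof -
  obtain x where x: "z \<in> J x" using regular_piece assms by blast
  have "T z \<notin> orb" using sing_orbits_graph[of z "T z"] x assms by (auto simp: graph_iff regular_iff)
  moreover have "(sigma2 (T z), sigma2 z) \<in> G"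
    using sigma2_linv[OF x] linv_reverse[OF x] by (auto simp: graph_iff)
  then have "sigma2 (T z) \<notin> orb" using sing_orbits_graph assms by (auto simp: regular_iff)
  ultimately show ?thesis using linv_interval[OF x] by (simp add: regular_iff)
qed

lemma regular_linv_ex:
  assumes "z \<in> R" shows "\<exists>y\<in>R. T y = z"
proof -
  have "sigma2 (T (sigma2 z)) \<in> R"
    by (rule regular_sigma2[OF regular_linv[OF regular_sigma2[OF assms]]])
  moreover obtain x where "sigma2 z \<in> J x" using regular_sigma2[OF assms] regular_piece by blast
  then have "T (sigma2 (T (sigma2 z))) = sigma2 (sigma2 z)" by (rule linv_reverse)
  moreover have "sigma2 (sigma2 z) = z" using assms by (simp add: regular_iff mem_double_interval)
  ultimately show ?thesis by auto
qed

lemma linv_inj_regular: "inj_on T R"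
proof (rule inj_onI)
  fix z z' assume "z \<in> R" "z' \<in> R" and eq: "T z = T z'"
  then obtain x x' where "z \<in> J x" "z' \<in> J x'" using regular_piece[of z] regular_piece[of z'] by blast
  then show "z = z'" using eq by (rule linv_inj)
qed

lemma image_regular: "T ` R = R"
proof (rule equalityI; rule subsetI)
  fix z assume "z \<in> T ` R"
  then obtain y where "z = T y" "y \<in> R" by (rule imageE)
  then show "z \<in> R" using regular_linv[of y] by simp
next
  fix z assume "z \<in> R"
  from regular_linv_ex[OF this] obtain y where y: "y \<in> R" "T y = z" ..
  from imageI[OF y(1), of T] show "z \<in> T ` R" unfolding y(2) .
qed

text \<open>
  There are finitely many separating points, \<open>T\<close> is a map, and \<open>T\<^sup>-\<^sup>1 = \<sigma>\<^sub>2 T \<sigma>\<^sub>2\<close>.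
\<close>

lemma countable_sing_orbits: "countable orb"
proof -
  have "sing p len \<subseteq> (\<lambda>x. (L x, lev x)) ` UNIV" by (auto simp: mem_sing)
  moreover have "finite (UNIV :: 'a letter set)" using all_letters by (metis List.finite_set)
  ultimately have S: "countable (sing p len)"
    by (meson countable_finite finite_imageI rev_finite_subset)
  have 1: "countable ((G ^^ n) `` sing p len)" for n
  proof (induction n)
    case (Suc n)
    have "(G ^^ Suc n) `` sing p len \<subseteq> T ` ((G ^^ n) `` sing p len)"
    proof
      fix y assume "y \<in> (G ^^ Suc n) `` sing p len"
      then obtain x u where "x \<in> sing p len" "(x, u) \<in> G ^^ n" "(u, y) \<in> G" by auto
      then show "y \<in> T ` ((G ^^ n) `` sing p len)" unfolding graph_iff by blast
    qed
    then show ?case by (rule countable_subset[OF _ countable_image[OF Suc]])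
  qed (simp add: S)
  have 2: "countable ((G ^^ n)\<inverse> `` sing p len)" for n
  proof (induction n)
    case (Suc n)
    have "(G ^^ Suc n)\<inverse> `` sing p len \<subseteq>
      (\<lambda>x. sigma2 (T (sigma2 x))) ` ((G ^^ n)\<inverse> `` sing p len)"
    proof
      fix y assume "y \<in> (G ^^ Suc n)\<inverse> `` sing p len"
      then obtain x where x: "x \<in> sing p len" "(y, x) \<in> G ^^ Suc n" by blast
      from x(2) obtain u where u: "(y, u) \<in> G" "(u, x) \<in> G ^^ n" by (rule relpow_Suc_E2)
      then obtain a where a: "y \<in> J a" "u = T y" unfolding graph_iff by blast
      then have "y = sigma2 (T (sigma2 u))"
        using linv_reverse[OF a(1)] row_cases[of a] by (simp add: mem_piece)
      then show "y \<in> (\<lambda>x. sigma2 (T (sigma2 x))) ` ((G ^^ n)\<inverse> `` sing p len)"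
        using u(2) x(1) by blast
    qed
    then show ?case by (rule countable_subset[OF _ countable_image[OF Suc]])
  qed (simp add: S)
  have "orb = (\<Union>n. (G ^^ n) `` sing p len \<union> (G ^^ n)\<inverse> `` sing p len)"
    by (auto simp: sing_orbits_def)
  then show ?thesis using 1 2 by simp
qed

end

section \<open>One step of the induction\<close>

text \<open>
  The effect of a Rauzy operation on a table whose winner \<open>w\<close> ends the row of level \<open>e\<close>: level 0 is the top
  operation and level 1 the bottom one. In the first case \<open>w\<close> is simple and the involution acts on
  its piece by a translation; in the second case \<open>w\<close> is duplicate and it acts by a flip.
\<close>

definition rauzy_move :: "nat \<Rightarrow> 'a letter \<Rightarrow> 'a letter \<Rightarrow> 'a letter table \<Rightarrow> 'a letter table \<Rightarrow> bool" where
  "rauzy_move e w l p q \<longleftrightarrow> (e = 0 \<or> e = 1) \<and>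
     ((\<exists>A B1 B2. table_row p e = A @ [w] \<and> table_row p (1 - e) = B1 @ inv_letter w # B2 @ [l] \<and>
        table_row q e = A @ [w] \<and> table_row q (1 - e) = B1 @ inv_letter w # l # B2) \<or>
      (\<exists>A1 A2 B. table_row p e = A1 @ inv_letter w # A2 @ [w] \<and> table_row p (1 - e) = B @ [l] \<and>
        table_row q e = A1 @ l # inv_letter w # A2 @ [w] \<and> table_row q (1 - e) = B))"

lemma rows_permuted:
  assumes "e = 0 \<or> e = (1::nat)"
    "mset (table_row q e) + mset (table_row q (1 - e)) = mset (table_row p e) + mset (table_row p (1 - e))"
  shows "mset (fst q @ snd q) = mset (fst p @ snd p)"
  using assms by (auto simp: table_row_def add.commute)

locale rauzy_step = linear_involution p len for p :: "'a letter table" and len +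
  fixes q :: "'a letter table" and e w l
  assumes move: "rauzy_move e w l p q"
    and shorter: "len (base l) < len (base w)"
begin

abbreviation "len' \<equiv> len(base w := len (base w) - len (base l))"

lemma e_cases: "e = 0 \<or> e = 1"
  using move by (simp add: rauzy_move_def)

lemma e_cases': "1 - e = 0 \<or> 1 - e = 1"
  using e_cases by auto

lemma base_neq: "base w \<noteq> base l"
  using shorter by auto

lemma len'_pos: "len' a > 0"
  using shorter len_pos by simp

lemma word_len_new: "w \<notin> set u \<Longrightarrow> inv_letter w \<notin> set u \<Longrightarrow> word_len len' u = word_len len u"
  by (rule word_len_cong) (auto simp: base_eq_iff)

lemma lev_winner: "lev w = e" and lev_loser: "lev l = 1 - e"
  and right_winner: "L w + len (base w) = width" and right_loser: "L l + len (base l) = width"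
proof -
  obtain A B where "table_row p e = A @ w # []" "table_row p (1 - e) = B @ l # []"
    using move by (auto simp: rauzy_move_def)
  then show "lev w = e" "lev l = 1 - e" "L w + len (base w) = width" "L l + len (base l) = width"
    using left_end_eq[OF e_cases] left_end_eq[OF e_cases'] word_len_row[of e] word_len_row[of "1 - e"]
    by auto
qed

lemma distinct_levels: "distinct (table_row p e @ table_row p (1 - e))"
  using distinct_letters e_cases by (auto simp: table_row_def)

lemma new_involution: "linear_involution q len'"
proof
  have "mset (table_row q e) + mset (table_row q (1 - e)) = mset (table_row p e) + mset (table_row p (1 - e))"
    using move by (auto simp: rauzy_move_def)
  then have m: "mset (fst q @ snd q) = mset (fst p @ snd p)"
    by (rule rows_permuted[OF e_cases])
  show "distinct (fst q @ snd q)"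
    using mset_eq_imp_distinct_iff[OF m] distinct_letters by blast
  show "set (fst q @ snd q) = UNIV"
    using mset_eq_setD[OF m] all_letters by simp
  show "len' a > 0" for a by (rule len'_pos)
  have "word_len len' (table_row q e) = word_len len' (table_row q (1 - e))"
    using move distinct_levels word_len_row[of e] word_len_row[of "1 - e"] base_neq
    by (auto simp: rauzy_move_def word_len_new)
  then show "word_len len' (fst q) = word_len len' (snd q)"
    using e_cases by (auto simp: table_row_def)
qed

sublocale new: linear_involution q len'
  by (rule new_involution)

text \<open>
  Only the loser changes its row, since it is inserted next to \<open>w\<^sup>-\<^sup>1\<close>.
\<close>

lemma new_lev: "new.lev x = (if x = l then lev (inv_letter w) else lev x)"
proof -
  have "x \<in> set (table_row q e) \<longleftrightarrow> (if x = l then lev (inv_letter w) = e else lev x = e)"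
    using move distinct_levels mem_row[OF e_cases, of x] mem_row[OF e_cases, of "inv_letter w"]
      mem_row[OF e_cases', of "inv_letter w"]
    by (auto simp: rauzy_move_def)
  then show ?thesis using e_cases new.mem_row[OF e_cases, of x] new.row_cases[of x] row_cases[of x]
      row_cases[of "inv_letter w"] by (auto split: if_splits)
qed

text \<open>
  The loser takes the right end of the interval of \<open>w\<^sup>-\<^sup>1\<close>. This interval is shortened by the length
  of the loser, so that nothing else moves.
\<close>

lemma new_left_translation:
  assumes "lev (inv_letter w) = 1 - e"
  shows "new.L x = (if x = l then L (inv_letter w) + len (base w) - len (base l) else L x)"
proof -
  obtain A B1 B2 where rows: "table_row p e = A @ [w]" "table_row p (1 - e) = B1 @ inv_letter w # B2 @ [l]"
    "table_row q e = A @ [w]" "table_row q (1 - e) = B1 @ inv_letter w # l # B2"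
  proof -
    have "inv_letter w \<notin> set (table_row p e)" using assms mem_row[OF e_cases, of "inv_letter w"] e_cases by auto
    then show ?thesis using move that by (auto simp: rauzy_move_def)
  qed
  have d: "w \<notin> set A" "inv_letter w \<notin> set A" "w \<notin> set B1" "inv_letter w \<notin> set B1" "w \<notin> set B2" "inv_letter w \<notin> set B2"
    using distinct_levels rows by auto
  have Lw: "L (inv_letter w) = word_len len B1" using left_end_eq(2)[OF e_cases' rows(2)] .
  have "x \<in> set (table_row p e) \<or> x \<in> set (table_row p (1 - e))"
    using all_letters e_cases by (auto simp: table_row_def)
  then consider "x \<in> set (A @ [w])" | "x \<in> set B1" | "x = inv_letter w" | "x \<in> set B2" | "x = l"
    using rows by auto
  then show ?thesis
  proof cases
    case 1
    then obtain u v where u: "A @ [w] = u @ x # v" by (meson split_list)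
    then have "w \<notin> set u" "inv_letter w \<notin> set u" using d
      by (cases v rule: rev_cases; force)+
    moreover have "x \<noteq> l" using 1 distinct_levels rows by auto
    ultimately show ?thesis using left_end_eq(2)[OF e_cases, of u x v] new.left_end_eq(2)[OF e_cases, of u x v] rows u
      by (simp add: word_len_new)
  next
    case 2
    then obtain u v where u: "B1 = u @ x # v" by (meson split_list)
    have "x \<noteq> l" using 2 distinct_levels rows by auto
    then show ?thesis using u d left_end_eq(2)[OF e_cases', of u x] new.left_end_eq(2)[OF e_cases', of u x] rows
      by (simp add: word_len_new)
  next
    case 3
    then show ?thesis using d Lw new.left_end_eq(2)[OF e_cases', of B1 "inv_letter w"] rows base_neq
      by (auto simp: word_len_new base_eq_iff)
  next
    case 4
    then obtain u v where u: "B2 = u @ x # v" by (meson split_list)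
    have "x \<noteq> l" using 4 distinct_levels rows by auto
    then show ?thesis using u d base_neq left_end_eq(2)[OF e_cases', of "B1 @ inv_letter w # u" x]
        new.left_end_eq(2)[OF e_cases', of "B1 @ inv_letter w # l # u" x] rows
      by (simp add: word_len_new)
  next
    case 5
    then show ?thesis using Lw d new.left_end_eq(2)[OF e_cases', of "B1 @ [inv_letter w]" l] rows
      by (simp add: word_len_new)
  qed
qed

text \<open>
  Here the flip carries the removed right end of the interval of \<open>w\<close> to the left end of the
  interval of \<open>w\<^sup>-\<^sup>1\<close>, which is where the loser is inserted.
\<close>

lemma new_left_flip:
  assumes "lev (inv_letter w) = e"
  shows "new.L x = (if x = l then L (inv_letter w)
    else if x = inv_letter w then L (inv_letter w) + len (base l) else L x)"
proof -
  obtain A1 A2 B where rows: "table_row p e = A1 @ inv_letter w # A2 @ [w]" "table_row p (1 - e) = B @ [l]"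
    "table_row q e = A1 @ l # inv_letter w # A2 @ [w]" "table_row q (1 - e) = B"
  proof -
    have "inv_letter w \<notin> set (table_row p (1 - e))" using assms mem_row[OF e_cases', of "inv_letter w"] e_cases by auto
    then show ?thesis using move that by (auto simp: rauzy_move_def)
  qed
  have d: "w \<notin> set A1" "inv_letter w \<notin> set A1" "w \<notin> set A2" "inv_letter w \<notin> set A2" "w \<notin> set B" "inv_letter w \<notin> set B"
    using distinct_levels rows by auto
  have Lw: "L (inv_letter w) = word_len len A1" using left_end_eq(2)[OF e_cases rows(1)] .
  have "x \<in> set (table_row p e) \<or> x \<in> set (table_row p (1 - e))"
    using all_letters e_cases by (auto simp: table_row_def)
  then consider "x \<in> set B" | "x \<in> set A1" | "x = inv_letter w" | "x \<in> set A2" | "x = w" | "x = l"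
    using rows by auto
  then show ?thesis
  proof cases
    case 1
    then obtain u v where u: "B = u @ x # v" by (meson split_list)
    have "x \<noteq> l" "x \<noteq> inv_letter w" using 1 distinct_levels rows by auto
    then show ?thesis using u d left_end_eq(2)[OF e_cases', of u x] new.left_end_eq(2)[OF e_cases', of u x] rows
      by (simp add: word_len_new)
  next
    case 2
    then obtain u v where u: "A1 = u @ x # v" by (meson split_list)
    have "x \<noteq> l" "x \<noteq> inv_letter w" using 2 distinct_levels rows by auto
    then show ?thesis using u d left_end_eq(2)[OF e_cases, of u x] new.left_end_eq(2)[OF e_cases, of u x] rows
      by (simp add: word_len_new)
  next
    case 3
    then show ?thesis using d Lw new.left_end_eq(2)[OF e_cases, of "A1 @ [l]" "inv_letter w"] rows base_neq
      by (auto simp: word_len_new base_eq_iff)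
  next
    case 4
    then obtain u v where u: "A2 = u @ x # v" by (meson split_list)
    have "x \<noteq> l" "x \<noteq> inv_letter w" using 4 distinct_levels rows by auto
    then show ?thesis using u d base_neq left_end_eq(2)[OF e_cases, of "A1 @ inv_letter w # u" x]
        new.left_end_eq(2)[OF e_cases, of "A1 @ l # inv_letter w # u" x] rows
      by (simp add: word_len_new)
  next
    case 5
    then show ?thesis using d base_neq left_end_eq(2)[OF e_cases, of "A1 @ inv_letter w # A2" w]
        new.left_end_eq(2)[OF e_cases, of "A1 @ l # inv_letter w # A2" w] rows
      by (auto simp add: word_len_new)
  next
    case 6
    then show ?thesis using Lw d new.left_end_eq(2)[OF e_cases, of A1 l] rows
      by (simp add: word_len_new)
  qed
qed

text \<open>
  The removed part on the losing level is exactly the interval of the loser.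
\<close>

lemma new_width: "word_len len' (fst q) = L l"
proof -
  have nw: "new.L w = L w"
  proof (cases "lev (inv_letter w) = e")
    case True
    then show ?thesis using new_left_flip[OF True, of w] base_neq by auto
  next
    case False
    then have "lev (inv_letter w) = 1 - e" using row_cases[of "inv_letter w"] e_cases by auto
    then show ?thesis using new_left_translation[of w] base_neq by auto
  qed
  obtain A where "table_row q e = A @ w # []"
    using move by (auto simp: rauzy_move_def)
  then show ?thesis
    using new.left_end_eq(2)[OF e_cases, of A w "[]"] new.word_len_row[of e] nw right_winner right_loser
    by auto
qed

lemma winner_cases:
  obtains (translation) "lev (inv_letter w) = 1 - e" "lev (inv_letter w) \<noteq> e"
    "\<And>x. new.L x = (if x = l then L (inv_letter w) + len (base w) - len (base l) else L x)"
  | (flip) "lev (inv_letter w) = e"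
    "\<And>x. new.L x = (if x = l then L (inv_letter w)
      else if x = inv_letter w then L (inv_letter w) + len (base l) else L x)"
proof (cases "lev (inv_letter w) = e")
  case True
  then show ?thesis using flip new_left_flip by blast
next
  case False
  then have "lev (inv_letter w) = 1 - e" using row_cases[of "inv_letter w"] e_cases by auto
  then show ?thesis using translation False new_left_translation by blast
qed

lemma letter_neqs [simp]: "w \<noteq> l" "l \<noteq> w" "w \<noteq> inv_letter l" "inv_letter l \<noteq> w"
  "inv_letter w \<noteq> l" "l \<noteq> inv_letter w"
  using base_neq by (auto simp: inv_letter_eq_iff)

lemma e_neq [simp]: "1 - e \<noteq> e" "e \<noteq> 1 - e" "1 - (1 - e) = e" "Suc 0 - e \<noteq> e" "e \<noteq> Suc 0 - e"
    "Suc 0 - (Suc 0 - e) = e"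
  using e_cases by auto

text \<open>
  The next three lemmas say how many steps of the old involution make up one step of the new one, and
  which old pieces these steps start from.
\<close>

lemma induced_other:
  assumes "x \<noteq> l" "x \<noteq> inv_letter l" "z \<in> new.J x"
  shows "z \<in> J x" "new.T z = T z"
proof -
  have ne: "base x \<noteq> base l" "inv_letter x \<noteq> l" "inv_letter x \<noteq> inv_letter l"
    using assms by (auto simp: base_eq_iff)
  have lb: "0 < len (base l)" by (rule len_pos)
  show J: "z \<in> J x"
    using winner_cases
  proof cases
    case translation
    then show ?thesis using assms ne lb shorter
      by (auto simp: mem_piece new.mem_piece new_lev split: if_splits)
  next
    case flip
    then show ?thesis using assms ne lb shorter
      by (auto simp: mem_piece new.mem_piece new_lev split: if_splits)
  qed
  show "new.T z = T z"
    using winner_cases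
  proof cases
    case translation
    then have "lev (inv_letter w) \<noteq> lev w" using lev_winner by simp
    then show ?thesis using assms ne lb shorter translation(3)
      unfolding linv_eq[OF J] new.linv_eq[OF assms(3)]
      by (cases "base x = base w") (auto simp: new_lev base_eq_iff)
  next
    case flip
    then show ?thesis using assms ne lb shorter lev_winner
      unfolding linv_eq[OF J] new.linv_eq[OF assms(3)]
      by (cases "base x = base w") (auto simp: new_lev base_eq_iff)
  qed
qed

lemma induced_loser:
  assumes z: "z \<in> new.J l"
  shows "z \<in> J (inv_letter w)" "T z \<in> J l" "new.T z = T (T z)"
proof -
  have lb: "0 < len (base l)" by (rule len_pos)
  have s: "snd z = lev (inv_letter w)" using z by (simp add: new.mem_piece new_lev)
  show J: "z \<in> J (inv_letter w)"
    using winner_cases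
  proof cases
    case translation
    then show ?thesis using z lb shorter base_neq s by (auto simp: mem_piece new.mem_piece)
  next
    case flip
    then show ?thesis using z lb shorter base_neq s by (auto simp: mem_piece new.mem_piece)
  qed
  have Tz: "fst (T z) = (if lev (inv_letter w) = e then L w + len (base w) - (fst z - L (inv_letter w))
      else L w + (fst z - L (inv_letter w)))" "snd (T z) = 1 - e"
    using lev_winner unfolding linv_eq[OF J] by auto
  show J2: "T z \<in> J l"
    using winner_cases
  proof cases
    case translation
    then show ?thesis using z lb shorter base_neq Tz right_winner right_loser lev_loser
      by (auto simp: mem_piece new.mem_piece)
  next
    case flip
    then show ?thesis using z lb shorter base_neq Tz right_winner right_loser lev_loser
      by (auto simp: mem_piece new.mem_piece)
  qed
  have TTz: "T (T z) = (if 1 - e \<noteq> lev (inv_letter l) then L (inv_letter l) + (fst (T z) - L l)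
     else L (inv_letter l) + len (base l) - (fst (T z) - L l), 1 - lev (inv_letter l))"
    unfolding linv_eq[OF J2] using lev_loser by simp
  have wl: "L w + len (base w) = L l + len (base l)" using right_winner right_loser by simp
  have le: "lev (inv_letter l) = e \<or> lev (inv_letter l) = 1 - e" using row_cases[of "inv_letter l"] e_cases by auto
  show "new.T z = T (T z)"
    using winner_cases
  proof cases
    case translation
    then show ?thesis using base_neq wl
      unfolding TTz new.linv_eq[OF z] by (simp add: new_lev Tz)
  next
    case flip
    have w: "new.lev (inv_letter l) = lev (inv_letter l)" "new.lev l = e"
      "new.L l = L (inv_letter w)" "new.L (inv_letter l) = L (inv_letter l)" "len' (base l) = len (base l)"
      using flip base_neq by (simp_all add: new_lev)
    have t: "fst (T z) = L w + len (base w) - (fst z - L (inv_letter w))" using Tz flip by simp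
    show ?thesis using le
    proof
      assume "lev (inv_letter l) = e"
      then show ?thesis unfolding TTz new.linv_eq[OF z] w t by (simp add: wl)
    next
      assume "lev (inv_letter l) = 1 - e"
      then show ?thesis unfolding TTz new.linv_eq[OF z] w t by (simp add: wl)
    qed
  qed
qed

lemma induced_loser_inverse:
  assumes z: "z \<in> new.J (inv_letter l)"
  shows "z \<in> J (inv_letter l)" "T z \<in> J w" "new.T z = T (T z)"
proof -
  have lb: "0 < len (base l)" by (rule len_pos)
  show J: "z \<in> J (inv_letter l)"
    using winner_cases
  proof cases
    case translation
    then show ?thesis using z lb shorter base_neq by (auto simp: mem_piece new.mem_piece new_lev)
  next
    case flip
    then show ?thesis using z lb shorter base_neq by (auto simp: mem_piece new.mem_piece new_lev)
  qed
  have b: "L (inv_letter l) < fst z" "fst z < L (inv_letter l) + len (base l)"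
    using J by (auto simp: mem_piece)
  have Tz: "fst (T z) = (if lev (inv_letter l) = 1 - e then L l + len (base l) - (fst z - L (inv_letter l))
      else L l + (fst z - L (inv_letter l)))" "snd (T z) = e"
    using lev_loser unfolding linv_eq[OF J] by auto
  have wl: "L w + len (base w) = L l + len (base l)" using right_winner right_loser by simp
  show J2: "T z \<in> J w"
    using lb shorter base_neq Tz wl lev_winner b by (auto simp: mem_piece)
  have TTz: "T (T z) = (if e \<noteq> lev (inv_letter w) then L (inv_letter w) + (fst (T z) - L w)
     else L (inv_letter w) + len (base w) - (fst (T z) - L w), 1 - lev (inv_letter w))"
    unfolding linv_eq[OF J2] using lev_winner by simp
  have le: "lev (inv_letter l) = e \<or> lev (inv_letter l) = 1 - e" using row_cases[of "inv_letter l"] e_cases by auto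
  show "new.T z = T (T z)"
    using winner_cases
  proof cases
    case translation
    then show ?thesis using base_neq wl le
      unfolding TTz new.linv_eq[OF z] by (auto simp add: new_lev Tz)
  next
    case flip
    then show ?thesis using base_neq wl le
      unfolding TTz new.linv_eq[OF z] by (auto simp add: new_lev Tz)
  qed
qed

text \<open>
  The point where the interval is cut is a separating point on the losing level.
\<close>

lemma cut_in_sing: "(L l, 1 - e) \<in> sing p len"
proof -
  have "0 \<le> L w" by (rule left_nonneg)
  then have "0 < L l" using right_winner right_loser shorter by simp
  then show ?thesis using lev_loser by (auto simp: mem_sing)
qed

text \<open>
  The only new separating point bounds the piece of the loser inside the old interval of \<open>w\<^sup>-\<^sup>1\<close>,
  and \<open>T\<close> maps it to the cut point.
\<close>

lemma new_sing:
  assumes "z \<in> sing q len'"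
  shows "z \<in> sing p len \<or> (\<exists>x. z \<in> J x \<and> T z \<in> sing p len)"
proof -
  obtain x where x: "z = (new.L x, new.lev x)" "new.L x > 0" using assms by (auto simp: new.mem_sing)
  have lb: "0 < len (base l)" by (rule len_pos)
  have wl: "L w + len (base w) = L l + len (base l)" using right_winner right_loser by simp
  show ?thesis
    using winner_cases
  proof cases
    case translation
    show ?thesis
    proof (cases "x = l")
      case True
      then have z: "z = (L (inv_letter w) + len (base w) - len (base l), 1 - e)"
        using x translation by (simp add: new_lev)
      then have J: "z \<in> J (inv_letter w)" using translation lb shorter by (auto simp: mem_piece)
      have "T z = (L l, 1 - e)"
        unfolding linv_eq[OF J] using z lev_winner translation wl by simp
      then show ?thesis using J cut_in_sing by auto
    next
      case False
      then show ?thesis using x translation by (auto simp: new_lev mem_sing)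
    qed
  next
    case flip
    consider "x = l" | "x = inv_letter w" | "x \<noteq> l" "x \<noteq> inv_letter w" by blast
    then show ?thesis
    proof cases
      case 1
      then show ?thesis using x flip by (auto simp: new_lev mem_sing)
    next
      case 2
      then have z: "z = (L (inv_letter w) + len (base l), e)"
        using x flip by (simp add: new_lev)
      then have J: "z \<in> J (inv_letter w)" using flip lb shorter by (auto simp: mem_piece)
      have "T z = (L l, 1 - e)"
        unfolding linv_eq[OF J] using z lev_winner flip wl by simp
      then show ?thesis using J cut_in_sing by auto
    next
      case 3
      then show ?thesis using x flip by (auto simp: new_lev mem_sing)
    qed
  qed
qed

lemma new_interval: "z \<in> double_interval q len' \<longleftrightarrow> z \<in> double_interval p len \<and> fst z < L l"
  using right_loser len_pos[of "base l"] by (auto simp: mem_double_interval new.mem_double_interval new_width)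

lemma new_graph: "(z, y) \<in> new.G \<Longrightarrow> (z, y) \<in> G \<or> (z, y) \<in> G ^^ 2"
proof -
  assume "(z, y) \<in> new.G"
  then obtain x where x: "z \<in> new.J x" "y = new.T z" by (auto simp: new.graph_iff)
  consider "x = l" | "x = inv_letter l" | "x \<noteq> l" "x \<noteq> inv_letter l" by blast
  then show ?thesis
  proof cases
    case 1
    then have "(z, T z) \<in> G" "(T z, y) \<in> G"
      using induced_loser[of z] x unfolding graph_iff by metis+
    then show ?thesis by (auto simp: numeral_2_eq_2)
  next
    case 2
    then have "(z, T z) \<in> G" "(T z, y) \<in> G"
      using induced_loser_inverse[of z] x unfolding graph_iff by metis+
    then show ?thesis by (auto simp: numeral_2_eq_2)
  next
    case 3
    then have "(z, y) \<in> G" using induced_other[of x z] x unfolding graph_iff by metis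
    then show ?thesis ..
  qed
qed

lemma new_graph_pow: "(z, y) \<in> new.G ^^ n \<Longrightarrow> \<exists>k. (z, y) \<in> G ^^ k"
proof (induction n arbitrary: y)
  case 0
  then show ?case by (intro exI[of _ 0]) simp
next
  case (Suc n)
  then obtain u where u: "(z, u) \<in> new.G ^^ n" "(u, y) \<in> new.G" by (elim relpow_Suc_E)
  obtain k where k: "(z, u) \<in> G ^^ k" using Suc.IH[OF u(1)] by blast
  from new_graph[OF u(2)] show ?case
  proof
    assume "(u, y) \<in> G"
    then have "(z, y) \<in> G ^^ Suc k" using k by auto
    then show ?thesis by blast
  next
    assume "(u, y) \<in> G ^^ 2"
    then have "(z, y) \<in> G ^^ (k + 2)" using k unfolding relpow_add by blast
    then show ?thesis by blast
  qed
qed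

lemma new_sing_forward: "z \<in> sing q len' \<Longrightarrow> \<exists>y\<in>sing p len. \<exists>k. (z, y) \<in> G ^^ k"
proof -
  assume "z \<in> sing q len'"
  from new_sing[OF this] show ?thesis
  proof
    assume "z \<in> sing p len"
    then show ?thesis by (intro bexI[of _ z] exI[of _ 0]) auto
  next
    assume "\<exists>x. z \<in> J x \<and> T z \<in> sing p len"
    then have "(z, T z) \<in> G ^^ 1" "T z \<in> sing p len" by (auto simp: graph_iff)
    then show ?thesis by blast
  qed
qed

lemma new_sing_backward: "z \<in> sing q len' \<Longrightarrow> \<exists>y\<in>sing p len. \<exists>k. (sigma2 y, sigma2 z) \<in> G ^^ k"
proof -
  assume "z \<in> sing q len'"
  from new_sing[OF this] show ?thesis
  proof
    assume "z \<in> sing p len"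
    then show ?thesis by (intro bexI[of _ z] exI[of _ 0]) auto
  next
    assume "\<exists>x. z \<in> J x \<and> T z \<in> sing p len"
    then obtain x where x: "z \<in> J x" "T z \<in> sing p len" by blast
    then have "(sigma2 (T z), sigma2 z) \<in> G ^^ 1"
      using sigma2_linv[OF x(1)] linv_reverse[OF x(1)] by (auto simp: graph_iff)
    then show ?thesis using x(2) by blast
  qed
qed

text \<open>
  A connection for the new involution extends at both ends to one for the old involution: its end
  moves forward to an old separating point, and its beginning comes from the \<open>\<sigma>\<^sub>2\<close>-image of one.
\<close>

lemma new_keane:
  assumes "keane p len" shows "keane q len'"
  unfolding keane_def
proof
  assume "\<exists>x y n. x \<in> sigma2 ` sing q len' \<and> y \<in> sing q len' \<and> (x, y) \<in> new.G ^^ n"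
  then obtain x y n where xy: "x \<in> sing q len'" "y \<in> sing q len'" "(sigma2 x, y) \<in> new.G ^^ n"
    by blast
  obtain x0 j where x0: "x0 \<in> sing p len" "(sigma2 x0, sigma2 x) \<in> G ^^ j"
    using new_sing_backward[OF xy(1)] by blast
  obtain y0 i where y0: "y0 \<in> sing p len" "(y, y0) \<in> G ^^ i"
    using new_sing_forward[OF xy(2)] by blast
  obtain k where "(sigma2 x, y) \<in> G ^^ k" using new_graph_pow[OF xy(3)] by blast
  then have "(sigma2 x0, y0) \<in> G ^^ (j + k + i)" using x0(2) y0(2) unfolding relpow_add by blast
  then show False using assms x0(1) y0(1) unfolding keane_def by blast
qed

lemma new_sing_orbits: "new.orb \<subseteq> orb"
proof
  fix y assume "y \<in> new.orb"
  then obtain x n where x: "x \<in> sing q len'" "(x, y) \<in> new.G ^^ n \<or> (y, x) \<in> new.G ^^ n"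
    unfolding sing_orbits_def by auto
  obtain x0 k where "x0 \<in> sing p len" "(x, x0) \<in> G ^^ k" using new_sing_forward[OF x(1)] by auto
  then have xo: "x \<in> orb" using sing_orbits_pow[of x x0 k] sing_orbitsI[of x0] by simp
  from x(2) show "y \<in> orb"
  proof
    assume "(x, y) \<in> new.G ^^ n"
    from new_graph_pow[OF this] obtain k where "(x, y) \<in> G ^^ k" ..
    from sing_orbits_pow[OF this] xo show ?thesis by simp
  next
    assume "(y, x) \<in> new.G ^^ n"
    from new_graph_pow[OF this] obtain k where "(y, x) \<in> G ^^ k" ..
    from sing_orbits_pow[OF this] xo show ?thesis by simp
  qed
qed

lemma new_regular: "z \<in> R \<Longrightarrow> fst z < L l \<Longrightarrow> z \<in> new.R"
  using subsetD[OF new_sing_orbits, of z] subsetD[OF new_sing_orbits, of "sigma2 z"]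
  by (simp add: regular_iff new.regular_iff new_interval) metis

text \<open>
  A regular point outside of the new double interval is in the piece of the loser or in the removed right end
  of the piece of the winner. Its preimage lies in the old piece \<open>w\<^sup>-\<^sup>1\<close> or \<open>l\<^sup>-\<^sup>1\<close>,
  respectively, inside the new double interval.
\<close>

lemma regular_cases:
  assumes "z \<in> R"
  shows "z \<in> new.R \<or> (\<exists>y\<in>R \<inter> new.R. T y = z)"
proof (cases "fst z < L l")
  case True
  then show ?thesis using assms new_regular[of z] by blast
next
  case False
  have zi: "z \<in> double_interval p len" and "sigma2 z \<in> double_interval p len"
    using assms sigma2_interval[of z] by (simp_all add: regular_iff)
  have lev_z: "snd z = e \<or> snd z = 1 - e" using zi e_cases by (auto simp: mem_double_interval)
  have "fst z \<noteq> L l"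
  proof
    assume "fst z = L l"
    then have "z = (L l, 1 - e) \<or> sigma2 z = (L l, 1 - e)"
      using lev_z by (cases z) (auto simp: sigma2_def)
    then show False using assms sing_orbitsI[OF cut_in_sing] by (auto simp: regular_iff)
  qed
  then have z: "L l < fst z" "fst z < L l + len (base l)"
    using False zi right_loser by (auto simp: mem_double_interval)
  obtain y where y: "y \<in> R" "T y = z" using regular_linv_ex[OF assms] by (elim bexE)
  obtain x where x: "y \<in> J x" using regular_piece[OF y(1)] by (elim exE)
  have z2: "(fst z, 1 - snd z) \<in> J (inv_letter x)"
    using sigma2_linv[OF x] y(2) by (simp add: sigma2_def)
  have wl: "L w + len (base w) = L l + len (base l)" using right_winner right_loser by simp
  have "fst y < L l"
  proof (cases "snd z = e")
    case True
    then have "(fst z, 1 - snd z) \<in> J l" using z lev_loser by (simp add: mem_piece)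
    then have "inv_letter x = l" using z2 by (metis piece_unique)
    then have xl: "y \<in> J (inv_letter l)" using x by auto
    show ?thesis
    proof (rule ccontr)
      \<comment> \<open>Right of the cut there are only points of the pieces \<open>w\<close> and \<open>l\<close>, and \<open>l\<^sup>-\<^sup>1\<close> is neither of them.\<close>
      assume c: "\<not> fst y < L l"
      have yw: "fst y < width" using piece_interval[OF x] by (simp add: mem_double_interval)
      show False
      proof (cases "snd y = e")
        case True
        then have "y \<in> J w" using c yw wl right_winner shorter lev_winner by (auto simp: mem_piece)
        then show ?thesis using piece_unique[OF xl] letter_neqs by blast
      next
        case False
        then have "snd y = 1 - e" using piece_interval[OF x] e_cases by (auto simp: mem_double_interval)
        moreover have "fst y \<noteq> L l"
        proof
          assume "fst y = L l"
          then have "y = (L l, 1 - e)" using \<open>snd y = 1 - e\<close> by (cases y) simp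
          then show False using y(1) sing_orbitsI[OF cut_in_sing] by (auto simp: regular_iff)
        qed
        ultimately have "y \<in> J l" using c yw right_loser lev_loser by (auto simp: mem_piece)
        then show ?thesis using piece_unique[OF xl] by (metis inv_letter_neq(1))
      qed
    qed
  next
    case False
    then have "(fst z, 1 - snd z) \<in> J w" using z lev_z lev_winner wl shorter by (auto simp: mem_piece)
    then have "inv_letter x = w" using z2 by (metis piece_unique)
    then have xw: "y \<in> J (inv_letter w)" using x by auto
    show ?thesis
    proof (cases "lev (inv_letter w) = e")
      case True
      then show ?thesis using xw pieces_separated[of w "inv_letter w"] lev_winner wl shorter
          right_le_width[of "inv_letter w"] right_winner len_pos[of "base l"]
        by (auto simp: mem_piece)
    next
      case False
      then have "lev (inv_letter w) = lev l" using row_cases[of "inv_letter w"] e_cases lev_loser by auto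
      then show ?thesis using xw pieces_separated[of l "inv_letter w"] lev_winner wl shorter
          right_le_width[of "inv_letter w"] right_loser len_pos[of "base w"]
        by (auto simp: mem_piece)
    qed
  qed
  then show ?thesis using y new_regular[of y] by blast
qed

end

section \<open>The induction step is defined\<close>

lemma insert_after_split: "a \<notin> set xs \<Longrightarrow> insert_after a b (xs @ a # ys) = xs @ a # b # ys"
  by (induction xs) auto

lemma insert_before_split: "a \<notin> set xs \<Longrightarrow> insert_before a b (xs @ a # ys) = xs @ b # a # ys"
  by (induction xs) auto

lemma word_len_distinct: "distinct u \<Longrightarrow> word_len f u = (\<Sum>x\<in>set u. f (base x))"
  by (simp add: word_len_def sum_list_distinct_conv_sum_set)

context linear_involution begin

lemma rows_disjoint:
  assumes "e = 0 \<or> e = 1"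
  shows "set (table_row p e) \<inter> set (table_row p (1 - e)) = {}"
  using assms distinct_letters by (auto simp: table_row_def)

lemma rows_cover:
  assumes "e = 0 \<or> e = 1"
  shows "set (table_row p e) \<union> set (table_row p (1 - e)) = UNIV"
  using assms all_letters by (auto simp: table_row_def)

text \<open>
  A row with a single letter \<open>x\<close> would force the other row, which contains \<open>x\<^sup>-\<^sup>1\<close> and all other
  letters, to be longer.
\<close>

lemma row_length:
  assumes "2 \<le> CARD('a)" and e: "e = 0 \<or> e = 1"
  shows "2 \<le> length (table_row p e)"
proof (rule ccontr)
  assume short: "\<not> ?thesis"
  have widths: "word_len len (table_row p e) = word_len len (table_row p (1 - e))"
    by (simp add: word_len_row)
  show False
  proof (cases "table_row p e")
    case Nil
    then have "table_row p (1 - e) = []"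
      using widths word_len_pos[of len "table_row p (1 - e)"] len_pos by fastforce
    then show False using Nil rows_cover[OF e] by simp
  next
    case (Cons x u)
    then have x: "table_row p e = [x]" using short by (cases u) auto
    have "inv_letter x \<in> set (table_row p e) \<union> set (table_row p (1 - e))"
      unfolding rows_cover[OF e] by simp
    then have "inv_letter x \<in> set (table_row p (1 - e))" by (simp add: x)
    then obtain u v where uv: "table_row p (1 - e) = u @ inv_letter x # v" by (meson split_list)
    then have "word_len len u + word_len len v = 0" using widths x by simp
    then have "u = []" "v = []"
      using word_len_pos[of len u] word_len_pos[of len v] word_len_nonneg[of len u] word_len_nonneg[of len v] len_pos
      by force+
    then have "y \<in> {x, inv_letter x}" for y using rows_cover[OF e] x uv by auto
    then have "Pos a \<in> {x, inv_letter x}" for a by blast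
    then have "base (Pos a) = base x" for a by fastforce
    then have "(UNIV :: 'a set) = {base x}" by auto
    then have "CARD('a) = 1" by (metis card_1_singleton_iff One_nat_def)
    then show False using assms(1) by simp
  qed
qed

text \<open>
  This is the condition under which the Rauzy operation is defined for a duplicate winner. If every
  letter of the losing row except possibly \<open>l\<close> had its inverse in the winning row, the winning row
  would contain these inverses and in addition both occurrences of \<open>w\<close>; as the rows have the same
  length, \<open>w\<close> could not be longer than \<open>l\<close>.
\<close>

lemma other_duplicate:
  assumes e: "e = 0 \<or> e = 1"
    and w: "w \<in> set (table_row p e)" "inv_letter w \<in> set (table_row p e)"
    and shorter: "len (base l) < len (base w)"
  shows "\<exists>z. z \<in> set (table_row p (1 - e)) \<and> inv_letter z \<in> set (table_row p (1 - e)) \<and> base z \<noteq> base l"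
proof (rule ccontr)
  assume none: "\<not> ?thesis"
  let ?f = "\<lambda>x. len (base x)"
  let ?X = "set (table_row p e)" and ?Y = "set (table_row p (1 - e))"
  have "inv_letter ` (?Y - {l, inv_letter l}) \<subseteq> ?X - {w, inv_letter w}"
  proof
    fix y assume "y \<in> inv_letter ` (?Y - {l, inv_letter l})"
    then obtain z where z: "y = inv_letter z" "z \<in> ?Y" "base z \<noteq> base l" by (auto simp: base_eq_iff)
    then have "y \<notin> ?Y" using none by auto
    then have "y \<in> ?X" using rows_cover[OF e] by blast
    moreover have "z \<noteq> w" "z \<noteq> inv_letter w" using z w rows_disjoint[OF e] by auto
    ultimately show "y \<in> ?X - {w, inv_letter w}" using z(1) by (auto simp: inv_letter_eq_iff)
  qed
  then have "sum ?f (inv_letter ` (?Y - {l, inv_letter l})) \<le> sum ?f (?X - {w, inv_letter w})"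
    by (intro sum_mono2) (auto simp: len_nonneg)
  also have "sum ?f (inv_letter ` (?Y - {l, inv_letter l})) = sum ?f (?Y - {l, inv_letter l})"
    by (subst sum.reindex) (auto simp: inj_on_def)
  finally have le: "sum ?f (?Y - {l, inv_letter l}) \<le> sum ?f (?X - {w, inv_letter w})" .
  have "sum ?f ?X = sum ?f {w, inv_letter w} + sum ?f (?X - {w, inv_letter w})"
    using w by (subst sum.subset_diff[of "{w, inv_letter w}"]) auto
  then have X: "sum ?f ?X = 2 * ?f w + sum ?f (?X - {w, inv_letter w})" by simp
  have "sum ?f ?Y \<le> sum ?f ((?Y - {l, inv_letter l}) \<union> {l, inv_letter l})"
    by (intro sum_mono2) (auto simp: len_nonneg)
  also have "\<dots> = sum ?f (?Y - {l, inv_letter l}) + sum ?f {l, inv_letter l}"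
    by (rule sum.union_disjoint) auto
  finally have "sum ?f ?Y \<le> sum ?f (?Y - {l, inv_letter l}) + 2 * ?f l" by simp
  moreover have "sum ?f ?X = sum ?f ?Y"
    using word_len_distinct[OF distinct_row[of e], of len] word_len_distinct[OF distinct_row[of "1 - e"], of len]
      word_len_row[of e] word_len_row[of "1 - e"] by simp
  ultimately show False using le X shorter by simp
qed

text \<open>
  The rows are permuted by \<open>e\<close> so that the bottom operation, which is the top operation of the
  table with exchanged rows, is covered as well.
\<close>

lemma rauzy_top_move:
  assumes card: "2 \<le> CARD('a)" and e: "e = 0 \<or> e = 1"
    and w: "w = last (table_row p e)" and l: "l = last (table_row p (1 - e))"
    and shorter: "len (base l) < len (base w)"
  shows "\<exists>Q. rauzy_top (table_row p e, table_row p (1 - e)) = Some Q \<and>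
    (\<forall>q. table_row q e = fst Q \<longrightarrow> table_row q (1 - e) = snd Q \<longrightarrow> rauzy_move e w l p q)"
proof -
  have e': "1 - e = 0 \<or> 1 - e = 1" using e by auto
  have "table_row p e \<noteq> []" "table_row p (1 - e) \<noteq> []"
    using row_length[OF card e] row_length[OF card e'] by auto
  then obtain A B where A: "table_row p e = A @ [w]" and B: "table_row p (1 - e) = B @ [l]"
    using w l by (metis append_butlast_last_id)
  have bne: "inv_letter w \<noteq> l" "base w \<noteq> base l" using shorter by auto
  have dA: "distinct (A @ [w])" and dB: "distinct (B @ [l])"
    using distinct_row[of e] distinct_row[of "1 - e"] A B by auto
  show ?thesis
  proof (cases "inv_letter w \<in> set (B @ [l])")
    case True
    then have "inv_letter w \<in> set B" using bne by simp
    then obtain B1 B2 where B12: "B = B1 @ inv_letter w # B2" by (meson split_list)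
    have "rauzy_top (A @ [w], B @ [l]) = Some (A @ [w], B1 @ inv_letter w # l # B2)"
      using True dB by (simp add: rauzy_top_def B12 insert_after_split butlast_append)
    then show ?thesis using A B B12 e by (fastforce simp: rauzy_move_def)
  next
    case False
    then have "inv_letter w \<in> set (A @ [w])" using rows_cover[OF e] A B by (metis UNIV_I UnE)
    moreover then have "\<exists>z. z \<in> set (B @ [l]) \<and> inv_letter z \<in> set (B @ [l]) \<and> base z \<noteq> base l"
      using other_duplicate[OF e _ _ shorter] A B by simp
    moreover have "inv_letter w \<in> set A" using calculation(1) by simp
    then obtain A1 A2 where A12: "A = A1 @ inv_letter w # A2" by (meson split_list)
    ultimately have "rauzy_top (A @ [w], B @ [l]) = Some (A1 @ l # inv_letter w # A2 @ [w], B)"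
      using False dA by (simp add: rauzy_top_def Let_def insert_before_split)
    then show ?thesis using A B A12 e by (fastforce simp: rauzy_move_def)
  qed
qed

text \<open>
  If the last intervals of the rows had the same length, their left end points would form a
  connection of length \<open>0\<close>.
\<close>

lemma last_lengths_differ:
  assumes card: "2 \<le> CARD('a)" and keane: "keane p len"
  shows "len (base (last (fst p))) \<noteq> len (base (last (snd p)))"
proof
  assume eq: "len (base (last (fst p))) = len (base (last (snd p)))"
  have last: "(width - len (base (last (table_row p e))), e) \<in> sing p len" if e: "e = 0 \<or> e = 1" for e
  proof -
    let ?r = "table_row p e"
    have r: "?r = butlast ?r @ last ?r # []" "butlast ?r \<noteq> []"
      using row_length[OF card e] by (cases ?r rule: rev_cases; fastforce)+
    have "L (last ?r) > 0" using left_end_eq(2)[OF e r(1)] word_len_pos[OF _ r(2), of len] len_pos by simp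
    moreover have "word_len len ?r = word_len len (butlast ?r) + len (base (last ?r))"
      using r(1) word_len_simps by (metis add.right_neutral)
    then have "width = L (last ?r) + len (base (last ?r))"
      using left_end_eq(2)[OF e r(1)] word_len_row[of e] by simp
    ultimately show ?thesis using left_end_eq(1)[OF e r(1)]
      unfolding mem_sing by (intro exI[of _ "last ?r"]) simp
  qed
  let ?t = "width - len (base (last (fst p)))"
  have "(?t, 0) \<in> sing p len" "(?t, 1) \<in> sing p len"
    using last[of 0] last[of 1] eq by (simp_all add: table_row_def)
  moreover have "sigma2 (?t, 0) = (?t, 1)" by (simp add: sigma2_def)
  moreover have "((?t, 1), (?t, 1)) \<in> G ^^ 0" by simp
  ultimately show False using keane unfolding keane_def by (metis image_eqI)
qed

lemma rv_step:
  assumes card: "2 \<le> CARD('a)" and keane: "keane p len"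
  defines "w \<equiv> winner (p, len)" and "l \<equiv> loser (p, len)"
  shows "\<exists>q e. rv (p, len) = Some (q, len(base w := len (base w) - len (base l))) \<and> rauzy_step p len q e w l"
proof (cases "top_wins (p, len)")
  case True
  then have wl: "w = last (table_row p 0)" "l = last (table_row p (1 - 0))" "len (base l) < len (base w)"
    by (auto simp: w_def l_def winner_def loser_def top_wins_def table_row_def)
  obtain Q where Q: "rauzy_top p = Some Q" "rauzy_move 0 w l p Q"
    using rauzy_top_move[OF card _ wl] by (auto simp: table_row_def)
  then have "rv (p, len) = Some (Q, len(base w := len (base w) - len (base l)))"
    using True by (simp add: rv_def Let_def w_def l_def)
  moreover have "rauzy_step p len Q 0 w l"
    using Q(2) wl(3) linear_involution_axioms by (simp add: rauzy_step_def rauzy_step_axioms_def)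
  ultimately show ?thesis by blast
next
  case False
  then have wl: "w = last (table_row p 1)" "l = last (table_row p (1 - 1))" "len (base l) < len (base w)"
    using last_lengths_differ[OF card keane]
    by (auto simp: w_def l_def winner_def loser_def top_wins_def table_row_def)
  then have bw: "bot_wins (p, len)" by (simp add: bot_wins_def table_row_def)
  obtain Q where Q: "rauzy_top (prod.swap p) = Some Q" "rauzy_move 1 w l p (prod.swap Q)"
    using rauzy_top_move[OF card _ wl] by (auto simp: table_row_def prod.swap_def)
  then have "rv (p, len) = Some (prod.swap Q, len(base w := len (base w) - len (base l)))"
    using False bw by (simp add: rv_def rauzy_bot_def Let_def w_def l_def)
  moreover have "rauzy_step p len (prod.swap Q) 1 w l"
    using Q(2) wl(3) linear_involution_axioms by (simp add: rauzy_step_def rauzy_step_axioms_def)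
  ultimately show ?thesis by blast
qed

end

section \<open>Coding of orbit segments\<close>

primrec codes :: "'a letter table \<Rightarrow> ('a \<Rightarrow> real) \<Rightarrow> point \<Rightarrow> 'a letter list \<Rightarrow> bool" where
  "codes p len z [] \<longleftrightarrow> True"
| "codes p len z (x # u) \<longleftrightarrow> z \<in> piece p len x \<and> codes p len (linv p len z) u"

lemma codes_nth: "codes p len z u \<Longrightarrow> i < length u \<Longrightarrow> (linv p len ^^ i) z \<in> piece p len (u ! i)"
proof (induction u arbitrary: z i)
  case (Cons x u)
  then show ?case by (cases i) (auto simp: funpow_swap1)
qed simp

text \<open>
  The substitution on positive words in the signed letters that underlies \<open>rv_morphism\<close>, without reduction
  in the free group.
\<close>

definition rv_image :: "'a letter \<Rightarrow> 'a letter \<Rightarrow> 'a letter \<Rightarrow> 'a letter list" where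
  "rv_image w l x = (if x = l then [inv_letter w, l]
     else if x = inv_letter l then [inv_letter l, w] else [x])"

lemma length_rv_image: "length u \<le> length (concat (map (rv_image w l) u))"
  by (induction u) (auto simp: rv_image_def)

lemma rv_morphism_eq:
  assumes "reduced (concat (map (rv_image w l) u))"
  shows "rv_morphism w l u = concat (map (rv_image w l) u)"
proof -
  have "rv_morphism w l u = reduce (concat (map (rv_image w l) u))"
    by (simp add: rv_morphism_def morphism_ext_def rv_image_def[abs_def])
  then show ?thesis using reduce_reduced[OF assms] by simp
qed

text \<open>
  The image of the piece \<open>x\<close> lies on the level opposite to \<open>x\<^sup>-\<^sup>1\<close>, so \<open>x\<^sup>-\<^sup>1\<close> cannot follow \<open>x\<close>.
\<close>

lemma (in linear_involution) codes_reduced: "codes p len z u \<Longrightarrow> reduced u"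
proof (induction u arbitrary: z)
  case (Cons x u)
  show ?case
  proof (cases u)
    case (Cons y v)
    then have x: "z \<in> J x" and y: "T z \<in> J y" using Cons.prems by auto
    have "codes p len (T z) u" using Cons.prems by simp
    then have "reduced u" by (rule Cons.IH)
    have "lev (inv_letter x) \<noteq> lev y"
      using sigma2_linv[OF x] y row_cases[of y] by (auto simp: mem_piece sigma2_def)
    then show ?thesis using Cons \<open>reduced u\<close> by auto
  qed simp
qed simp

lemma funpow_length_Cons: "(f ^^ length (x # u)) z = (f ^^ length u) (f z)"
  by (simp add: funpow_swap1)

lemma (in rauzy_step) codes_image:
  "codes q len' z u \<Longrightarrow> codes p len z (concat (map (rv_image w l) u)) \<and>
     (T ^^ length (concat (map (rv_image w l) u))) z = (new.T ^^ length u) z"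
proof (induction u arbitrary: z)
  case (Cons x u)
  have z: "z \<in> new.J x" and "codes q len' (new.T z) u"
    using Cons.prems unfolding codes.simps by (rule conjunct1, rule conjunct2)
  note u = Cons.IH[OF this(2)]
  consider "x = l" | "x = inv_letter l" | "x \<noteq> l" "x \<noteq> inv_letter l" by blast
  then show ?case
  proof cases
    case 1
    have image: "concat (map (rv_image w l) (x # u)) = inv_letter w # l # concat (map (rv_image w l) u)"
      by (simp add: rv_image_def 1)
    show ?thesis
      unfolding image funpow_length_Cons codes.simps induced_loser(3)[OF z[unfolded 1], symmetric]
      using u induced_loser(1,2)[OF z[unfolded 1]] by blast
  next
    case 2
    have image: "concat (map (rv_image w l) (x # u)) = inv_letter l # w # concat (map (rv_image w l) u)"
      by (simp add: rv_image_def 2)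
    show ?thesis
      unfolding image funpow_length_Cons codes.simps induced_loser_inverse(3)[OF z[unfolded 2], symmetric]
      using u induced_loser_inverse(1,2)[OF z[unfolded 2]] by blast
  next
    case 3
    then have image: "concat (map (rv_image w l) (x # u)) = x # concat (map (rv_image w l) u)"
      by (simp add: rv_image_def)
    show ?thesis
      unfolding image funpow_length_Cons codes.simps induced_other(2)[OF 3 z, symmetric]
      using u induced_other(1)[OF 3 z] by blast
  qed
qed simp

lemma funpow_add_apply: "(f ^^ (m + n)) z = (f ^^ m) ((f ^^ n) z)"
  by (simp add: funpow_add)

text \<open>
  The successive stages of the induction: \<open>P n\<close> and \<open>\<Lambda> n\<close> are the table and the lengths after \<open>n\<close>
  steps, \<open>W n\<close> and \<open>V n\<close> the winner and the loser of the step from stage \<open>n\<close>.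
\<close>

locale rauzy_sequence =
  fixes P :: "nat \<Rightarrow> 'a letter table" and \<Lambda> :: "nat \<Rightarrow> 'a \<Rightarrow> real"
    and W V :: "nat \<Rightarrow> 'a letter"
  assumes steps: "\<exists>e. rauzy_step (P n) (\<Lambda> n) (P (Suc n)) e (W n) (V n)"
    and lengths: "\<Lambda> (Suc n) = (\<Lambda> n)(base (W n) := \<Lambda> n (base (W n)) - \<Lambda> n (base (V n)))"
    and keane_all: "keane (P n) (\<Lambda> n)"
begin

abbreviation "\<tau> n \<equiv> rv_morphism (W n) (V n)"
abbreviation "U N u \<equiv> compose_upto \<tau> N u"
abbreviation "TT n \<equiv> linv (P n) (\<Lambda> n)"
abbreviation "RR n \<equiv> regular_points (P n) (\<Lambda> n)"

sublocale stage: linear_involution "P n" "\<Lambda> n" for n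
  using steps[of n] by (auto simp: rauzy_step_def)

text \<open>
  Morphisms are applied from the innermost one, \<open>\<tau>\<^sub>N\<^sub>-\<^sub>1\<close>, outwards, so the coding descends one stage
  at a time. At each stage the coded word is reduced, which makes the morphism agree with the substitution.
\<close>

lemma codes_compose:
  "codes (P N) (\<Lambda> N) z u \<Longrightarrow> codes (P 0) (\<Lambda> 0) z (U N u) \<and>
     (TT 0 ^^ length (U N u)) z = (TT N ^^ length u) z \<and> length u \<le> length (U N u)"
proof (induction N arbitrary: u)
  case (Suc N)
  obtain e where "rauzy_step (P N) (\<Lambda> N) (P (Suc N)) e (W N) (V N)" using steps by blast
  then interpret rauzy_step "P N" "\<Lambda> N" "P (Suc N)" e "W N" "V N" .
  let ?v = "concat (map (rv_image (W N) (V N)) u)"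
  have v: "codes (P N) (\<Lambda> N) z ?v" "(TT N ^^ length ?v) z = (TT (Suc N) ^^ length u) z"
    using codes_image[of z u] Suc.prems unfolding lengths by blast+
  then have "\<tau> N u = ?v" using rv_morphism_eq[OF stage.codes_reduced[OF v(1)]] by simp
  then have "U (Suc N) u = U N ?v" by simp
  then show ?case using Suc.IH[OF v(1)] v(2) length_rv_image[of u "W N" "V N"] by simp
qed simp

text \<open>
  One step of stage \<open>N\<close> consists of at least one step of \<open>T\<close>; during these steps the word of the
  piece \<open>x\<close> is read.
\<close>

lemma return_time:
  assumes "z \<in> RR N"
  shows "\<exists>x. z \<in> piece (P N) (\<Lambda> N) x \<and> TT N z \<in> RR N \<and> codes (P 0) (\<Lambda> 0) z (U N [x]) \<and>
    (TT 0 ^^ length (U N [x])) z = TT N z \<and> 0 < length (U N [x])"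
proof -
  obtain x where "z \<in> piece (P N) (\<Lambda> N) x" using stage.regular_piece[OF assms] by blast
  then show ?thesis using codes_compose[of N z "[x]"] stage.regular_linv[OF assms] by auto
qed

lemma regular_from_stage: "z \<in> RR 0 \<Longrightarrow> \<exists>y\<in>RR N. \<exists>k. (TT 0 ^^ k) y = z"
proof (induction N)
  case 0
  then show ?case by (intro bexI[of _ z] exI[of _ 0]) auto
next
  case (Suc N)
  then obtain y k where y: "y \<in> RR N" "(TT 0 ^^ k) y = z" by blast
  obtain e where "rauzy_step (P N) (\<Lambda> N) (P (Suc N)) e (W N) (V N)" using steps by blast
  then interpret rauzy_step "P N" "\<Lambda> N" "P (Suc N)" e "W N" "V N" .
  from regular_cases[OF y(1), folded lengths] show ?case
  proof
    assume "y \<in> RR (Suc N)"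
    then show ?thesis using y(2) by blast
  next
    assume "\<exists>y'\<in>RR N \<inter> RR (Suc N). TT N y' = y"
    then obtain y' where y': "y' \<in> RR N" "y' \<in> RR (Suc N)" "TT N y' = y" by (elim bexE IntE)
    obtain j where "(TT 0 ^^ j) y' = y" using return_time[OF y'(1)] y'(3) by metis
    then have "(TT 0 ^^ (k + j)) y' = z" using y(2) by (simp add: funpow_add)
    then show ?thesis using y'(2) by blast
  qed
qed

text \<open>
  Go back from \<open>z\<close> to the last visit \<open>y\<close> of stage \<open>N\<close>. The segment ends before the return of
  \<open>y\<close> to stage \<open>N\<close>, because it avoids this stage.
\<close>

lemma coding_in_return_word:
  assumes z: "z \<in> RR 0" and codes: "\<And>i. i < length u \<Longrightarrow> (TT 0 ^^ i) z \<in> piece (P 0) (\<Lambda> 0) (u ! i)"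
    and avoid: "\<And>i. i < length u \<Longrightarrow> (TT 0 ^^ i) z \<notin> RR N" and "u \<noteq> []"
  shows "\<exists>x. sublist u (U N [x])"
proof -
  let ?hits = "\<lambda>k. \<exists>y\<in>RR N. (TT 0 ^^ k) y = z"
  define k where "k = (LEAST k. ?hits k)"
  have "\<exists>k. ?hits k" using regular_from_stage[OF z, of N] by blast
  then have "?hits k" unfolding k_def by (rule LeastI_ex)
  then obtain y where y: "y \<in> RR N" "(TT 0 ^^ k) y = z" by blast
  obtain x where x: "TT N y \<in> RR N" "codes (P 0) (\<Lambda> 0) y (U N [x])"
    "(TT 0 ^^ length (U N [x])) y = TT N y" "0 < length (U N [x])"
    using return_time[OF y(1)] by blast
  let ?v = "U N [x]"
  have kl: "k < length ?v"
  proof (rule ccontr)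
    assume "\<not> ?thesis"
    then have "(k - length ?v) + length ?v = k" by simp
    then have "(TT 0 ^^ (k - length ?v)) (TT N y) = z"
      using y(2) x(3) funpow_add_apply[of "k - length ?v" "length ?v" "TT 0" y] by simp
    then have "?hits (k - length ?v)" by (rule bexI[OF _ x(1)])
    then have "k \<le> k - length ?v" unfolding k_def by (rule Least_le)
    then show False using x(4) \<open>\<not> k < length ?v\<close> by linarith
  qed
  have le: "k + length u \<le> length ?v"
  proof (rule ccontr)
    assume "\<not> ?thesis"
    then have i: "length ?v - k < length u" and "(length ?v - k) + k = length ?v" using kl by simp_all
    then have "(TT 0 ^^ (length ?v - k)) z = TT N y"
      using y(2) x(3) funpow_add_apply[of "length ?v - k" k "TT 0" y] by simp
    then show False using avoid[OF i] x(1) by simp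
  qed
  have "u ! i = ?v ! (k + i)" if i: "i < length u" for i
  proof -
    have "(TT 0 ^^ (k + i)) y \<in> piece (P 0) (\<Lambda> 0) (?v ! (k + i))" using codes_nth[OF x(2)] i le by simp
    moreover have "(TT 0 ^^ (k + i)) y = (TT 0 ^^ i) z" 
      using y(2) funpow_add_apply[of i k "TT 0" y] by (simp add: add.commute)
    ultimately have "(TT 0 ^^ i) z \<in> piece (P 0) (\<Lambda> 0) (?v ! (k + i))" by simp
    then show ?thesis using codes[OF i] stage.piece_unique[of _ 0] by blast
  qed
  then have u: "take (length u) (drop k ?v) = u" using le by (intro nth_equalityI) auto
  have "sublist (take (length u) (drop k ?v)) ?v"
    using sublist_order.order.trans[OF sublist_take sublist_drop] .
  then have "sublist u ?v" unfolding u .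
  then show ?thesis ..
qed

end

section \<open>The intervals shrink to a point\<close>

context rauzy_sequence begin

lemma length_Suc_le: "\<Lambda> (Suc n) a \<le> \<Lambda> n a"
  using stage.len_pos[of n "base (V n)"] by (simp add: lengths)

lemma length_mono: "m \<le> n \<Longrightarrow> \<Lambda> n a \<le> \<Lambda> m a"
  by (rule lift_Suc_antimono_le[of "\<lambda>n. \<Lambda> n a"]) (auto simp: length_Suc_le)

end

lemma rauzy_move_lasts:
  assumes "rauzy_move e w l p q" "e = 0 \<or> e = 1"
  shows "table_row p e \<noteq> []" "last (table_row p e) = w" "table_row p (1 - e) \<noteq> []" "last (table_row p (1 - e)) = l"
    "table_row q e \<noteq> []" "last (table_row q e) = w"
  using assms by (auto simp: rauzy_move_def)

locale finite_rauzy_sequence = rauzy_sequence P \<Lambda> W V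
  for P :: "nat \<Rightarrow> 'a::finite letter table" and \<Lambda> W V
begin

text \<open>
  The sum of all lengths is positive and drops by the length of the loser in every step.
\<close>

lemma loser_length_tendsto: "(\<lambda>n. \<Lambda> n (base (V n))) \<longlonglongrightarrow> 0"
proof -
  define S where "S n = (\<Sum>a\<in>UNIV. \<Lambda> n a)" for n
  have step: "S (Suc n) = S n - \<Lambda> n (base (V n))" for n
  proof -
    have "S (Suc n) = (\<Lambda> n (base (W n)) - \<Lambda> n (base (V n))) + (\<Sum>a\<in>UNIV - {base (W n)}. \<Lambda> n a)"
      unfolding S_def by (subst sum.remove[of _ "base (W n)"]) (auto simp: lengths)
    moreover have "S n = \<Lambda> n (base (W n)) + (\<Sum>a\<in>UNIV - {base (W n)}. \<Lambda> n a)"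
      unfolding S_def by (rule sum.remove) auto
    ultimately show ?thesis by simp
  qed
  have "decseq S" by (rule decseq_SucI) (simp add: step stage.len_nonneg)
  moreover have "0 \<le> S n" for n by (simp add: S_def sum_nonneg stage.len_nonneg)
  ultimately obtain s where s: "S \<longlonglongrightarrow> s" using decseq_convergent by blast
  have "(\<lambda>n. S n - S (Suc n)) \<longlonglongrightarrow> s - s" by (intro tendsto_diff s LIMSEQ_Suc)
  then show ?thesis by (simp add: step)
qed

lemma infinite_loser_tendsto:
  assumes "\<exists>\<^sub>\<infinity>n. base (V n) = a" shows "(\<lambda>n. \<Lambda> n a) \<longlonglongrightarrow> 0"
proof (rule LIMSEQ_I)
  fix r :: real assume "0 < r"
  then have "eventually (\<lambda>n. \<Lambda> n (base (V n)) < r) sequentially"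
    using loser_length_tendsto order_tendstoD(2) by blast
  then obtain N where N: "\<And>n. n \<ge> N \<Longrightarrow> \<Lambda> n (base (V n)) < r" by (auto simp: eventually_sequentially)
  obtain m where "m \<ge> N" "base (V m) = a" using assms by (auto simp: INFM_nat_le)
  then have "\<Lambda> m a < r" using N by auto
  then have "\<Lambda> n a < r" if "n \<ge> m" for n using length_mono[OF that, of a] by simp
  then show "\<exists>no. \<forall>n\<ge>no. norm (\<Lambda> n a - 0) < r" using stage.len_nonneg by auto
qed

text \<open>
  The winner stays at the end of its row.
\<close>

lemma next_stage: "W (Suc n) = W n \<or> V (Suc n) = W n"
proof -
  obtain e where "rauzy_step (P n) (\<Lambda> n) (P (Suc n)) e (W n) (V n)" using steps by blast
  then have 1: "rauzy_move e (W n) (V n) (P n) (P (Suc n))" "e = 0 \<or> e = 1"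
    by (auto simp: rauzy_step_def rauzy_step_axioms_def rauzy_move_def)
  obtain f where "rauzy_step (P (Suc n)) (\<Lambda> (Suc n)) (P (Suc (Suc n))) f (W (Suc n)) (V (Suc n))"
    using steps by blast
  then have 2: "rauzy_move f (W (Suc n)) (V (Suc n)) (P (Suc n)) (P (Suc (Suc n)))" "f = 0 \<or> f = 1"
    by (auto simp: rauzy_step_def rauzy_step_axioms_def rauzy_move_def)
  have "e = f \<or> e = 1 - f" using 1 2 by auto
  then show ?thesis using rauzy_move_lasts[OF 1] rauzy_move_lasts[OF 2] by metis
qed

lemma lengths_bounded_below: "\<exists>c>0. \<forall>a. c \<le> \<Lambda> n a"
  using stage.len_pos[of n]
  by (intro exI[of _ "Min (range (\<Lambda> n))"]) (auto simp: Min_gr_iff)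

text \<open>
  Otherwise the same letter would win for ever from some stage on. All losers would then keep their
  lengths, which could not tend to \<open>0\<close>.
\<close>

lemma infinite_winner_loses:
  assumes inf: "\<exists>\<^sub>\<infinity>n. base (W n) = a" shows "\<exists>\<^sub>\<infinity>n. base (V n) = a"
proof (rule ccontr)
  assume "\<not> ?thesis"
  then obtain N where N: "\<And>n. n \<ge> N \<Longrightarrow> base (V n) \<noteq> a" by (auto simp: INFM_nat_le)
  obtain m where m: "m \<ge> N" "base (W m) = a" using inf by (auto simp: INFM_nat_le)
  have const: "W (m + k) = W m" for k
  proof (induction k)
    case (Suc k)
    then have "V (Suc (m + k)) \<noteq> W m" using N[of "Suc (m + k)"] m by auto
    then show ?case using next_stage[of "m + k"] Suc by auto
  qed simp
  have same: "\<Lambda> (m + k) b = \<Lambda> m b" if "b \<noteq> a" for k b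
    by (induction k) (use that m const in \<open>auto simp: lengths\<close>)
  obtain c where c: "c > 0" "\<And>b. c \<le> \<Lambda> m b" using lengths_bounded_below by blast
  obtain K where "\<And>n. n \<ge> K \<Longrightarrow> \<Lambda> n (base (V n)) < c"
    using order_tendstoD(2)[OF loser_length_tendsto c(1)] by (auto simp: eventually_sequentially)
  then have "\<Lambda> (m + K) (base (V (m + K))) < c" by simp
  moreover have "base (V (m + K)) \<noteq> a" using N m by simp
  ultimately show False using same c(2)[of "base (V (m + K))"] by simp
qed

text \<open>
  A letter that no longer wins keeps its length, but the length of a letter that loses infinitely
  often tends to \<open>0\<close>.
\<close>

lemma infinite_loser_wins:
  assumes inf: "\<exists>\<^sub>\<infinity>n. base (V n) = a" shows "\<exists>\<^sub>\<infinity>n. base (W n) = a"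
proof (rule ccontr)
  assume "\<not> ?thesis"
  then obtain N where N: "\<And>n. n \<ge> N \<Longrightarrow> base (W n) \<noteq> a" by (auto simp: INFM_nat_le)
  have "\<Lambda> (N + k) a = \<Lambda> N a" for k
  proof (induction k)
    case (Suc k)
    then show ?case using N[of "N + k"] by (simp add: lengths)
  qed simp
  then have "(\<lambda>k. \<Lambda> (k + N) a) = (\<lambda>k. \<Lambda> N a)" by (simp add: add.commute)
  moreover have "(\<lambda>k. \<Lambda> (k + N) a) \<longlonglongrightarrow> 0"
    using infinite_loser_tendsto[OF inf] by (rule LIMSEQ_ignore_initial_segment)
  ultimately have "\<Lambda> N a = 0" by (simp add: LIMSEQ_const_iff)
  then show False using stage.len_pos[of N a] by simp
qed

definition active :: "'a set" where "active = {a. \<exists>\<^sub>\<infinity>n. base (W n) = a}"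

lemma active_tendsto: "a \<in> active \<Longrightarrow> (\<lambda>n. \<Lambda> n a) \<longlonglongrightarrow> 0"
  by (simp add: active_def infinite_winner_loses infinite_loser_tendsto)

lemma eventually_active: "\<exists>N. \<forall>n\<ge>N. base (W n) \<in> active \<and> base (V n) \<in> active"
proof -
  have "\<exists>N. \<forall>n\<ge>N. base (W n) \<noteq> a \<and> base (V n) \<noteq> a" if "a \<notin> active" for a
  proof -
    have "\<not> (\<exists>\<^sub>\<infinity>n. base (W n) = a)" using that by (simp add: active_def)
    moreover from this have "\<not> (\<exists>\<^sub>\<infinity>n. base (V n) = a)" using infinite_loser_wins[of a] by blast
    ultimately obtain k m where "\<forall>n\<ge>k. base (W n) \<noteq> a" "\<forall>n\<ge>m. base (V n) \<noteq> a"
      by (auto simp: INFM_nat_le)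
    then show ?thesis by (intro exI[of _ "max k m"]) simp
  qed
  then have "\<forall>a\<in>- active. \<exists>N. \<forall>n\<ge>N. base (W n) \<noteq> a \<and> base (V n) \<noteq> a" by blast
  then obtain f where f: "\<forall>a\<in>- active. \<forall>n\<ge>f a. base (W n) \<noteq> a \<and> base (V n) \<noteq> a"
    unfolding bchoice_iff by blast
  have "f a \<le> Max (range f)" for a by simp
  then have "base (W n) \<in> active \<and> base (V n) \<in> active" if "n \<ge> Max (range f)" for n
    using f le_trans[OF _ that] by blast
  then show ?thesis by blast
qed

end

text \<open>
  The shortest prefix containing all entries with the property \<open>Q\<close>; it is empty or ends with such an entry.
\<close>

definition prefix_until :: "('b \<Rightarrow> bool) \<Rightarrow> 'b list \<Rightarrow> 'b list" where
  "prefix_until Q u = rev (dropWhile (\<lambda>x. \<not> Q x) (rev u))"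

lemma prefix_until_simps:
  "prefix_until Q [] = []"
  "prefix_until Q (u @ [x]) = (if Q x then u @ [x] else prefix_until Q u)"
  by (simp_all add: prefix_until_def)

lemma prefix_until_append:
  "prefix_until Q (u @ v) = (if \<exists>x\<in>set v. Q x then u @ prefix_until Q v else prefix_until Q u)"
  by (induction v rule: rev_induct) (auto simp: prefix_until_simps simp flip: append_assoc)

lemma prefix_until_Cons:
  "prefix_until Q (x # v) = (if \<exists>x\<in>set v. Q x then x # prefix_until Q v else if Q x then [x] else [])"
  using prefix_until_append[of Q "[x]" v] prefix_until_simps(2)[of Q "[]" x] prefix_until_simps(1)[of Q] by auto

lemma prefix_until_split:
  "\<exists>v. u = prefix_until Q u @ v \<and> (\<forall>x\<in>set v. \<not> Q x)"
proof (intro exI conjI ballI)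
  show "u = prefix_until Q u @ rev (takeWhile (\<lambda>x. \<not> Q x) (rev u))"
    by (metis prefix_until_def rev_append rev_rev_ident takeWhile_dropWhile_id)
qed (auto dest: set_takeWhileD)

lemma set_prefix_until: "set (prefix_until Q u) \<subseteq> set u"
  using prefix_until_split[of u Q] by (metis Un_iff set_append subsetI)

text \<open>
  With \<open>Q\<close> selecting inactive letters: the loser leaves from behind the last such letter of its
  row, and it is inserted either also behind the last such letter of a row, or before it, in which
  case that prefix becomes longer. The latter happens when \<open>w\<^sup>-\<^sup>1\<close> belongs to the prefix.
\<close>

lemma move_prefix:
  assumes move: "rauzy_move e w l p q" and d: "distinct (table_row p e @ table_row p (1 - e))"
    and Q: "\<not> Q w" "\<not> Q (inv_letter w)" "\<not> Q l"
  defines "pre r i \<equiv> prefix_until Q (table_row r i)"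
  shows "pre q e = pre p e \<and> pre q (1 - e) = pre p (1 - e) \<and>
      {w, inv_letter w} \<inter> (set (pre p e) \<union> set (pre p (1 - e))) = {} \<or>
    length (pre p e) + length (pre p (1 - e)) < length (pre q e) + length (pre q (1 - e))"
proof -
  have "(\<exists>A B1 B2. table_row p e = A @ [w] \<and> table_row p (1 - e) = B1 @ inv_letter w # B2 @ [l] \<and>
        table_row q e = A @ [w] \<and> table_row q (1 - e) = B1 @ inv_letter w # l # B2) \<or>
      (\<exists>A1 A2 B. table_row p e = A1 @ inv_letter w # A2 @ [w] \<and> table_row p (1 - e) = B @ [l] \<and>
        table_row q e = A1 @ l # inv_letter w # A2 @ [w] \<and> table_row q (1 - e) = B)"
    using move by (simp add: rauzy_move_def)
  then show ?thesis
  proof (elim disjE exE conjE)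
    fix A B1 B2
    assume r: "table_row p e = A @ [w]" "table_row p (1 - e) = B1 @ inv_letter w # B2 @ [l]"
      "table_row q e = A @ [w]" "table_row q (1 - e) = B1 @ inv_letter w # l # B2"
    have "w \<notin> set A" "inv_letter w \<notin> set A" "w \<notin> set B1" "inv_letter w \<notin> set B1" using d r by auto
    then have "w \<notin> set (prefix_until Q A)" "inv_letter w \<notin> set (prefix_until Q A)"
      "w \<notin> set (prefix_until Q B1)" "inv_letter w \<notin> set (prefix_until Q B1)"
      using set_prefix_until by fast+
    then show ?thesis using Q unfolding pre_def r
      by (auto simp: prefix_until_append prefix_until_Cons prefix_until_simps)
  next
    fix A1 A2 B
    assume r: "table_row p e = A1 @ inv_letter w # A2 @ [w]" "table_row p (1 - e) = B @ [l]"
      "table_row q e = A1 @ l # inv_letter w # A2 @ [w]" "table_row q (1 - e) = B"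
    have "w \<notin> set B" "inv_letter w \<notin> set B" "w \<notin> set A1" "inv_letter w \<notin> set A1" using d r by auto
    then have "w \<notin> set (prefix_until Q B)" "inv_letter w \<notin> set (prefix_until Q B)"
      "w \<notin> set (prefix_until Q A1)" "inv_letter w \<notin> set (prefix_until Q A1)"
      using set_prefix_until by fast+
    then show ?thesis using Q unfolding pre_def r
      by (auto simp: prefix_until_append prefix_until_Cons prefix_until_simps)
  qed
qed

context finite_rauzy_sequence begin

abbreviation "pre n i \<equiv> prefix_until (\<lambda>x. base x \<notin> active) (table_row (P n) i)"

lemma pre_step:
  assumes "base (W n) \<in> active" "base (V n) \<in> active"
  shows "(\<forall>i\<in>{0, 1}. pre (Suc n) i = pre n i \<and> W n \<notin> set (pre n i) \<and> inv_letter (W n) \<notin> set (pre n i)) \<or>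
    length (pre n 0) + length (pre n 1) < length (pre (Suc n) 0) + length (pre (Suc n) 1)"
proof -
  obtain e where s: "rauzy_step (P n) (\<Lambda> n) (P (Suc n)) e (W n) (V n)" using steps by blast
  have m: "rauzy_move e (W n) (V n) (P n) (P (Suc n))" "e = 0 \<or> e = 1"
    "distinct (table_row (P n) e @ table_row (P n) (1 - e))"
    using rauzy_step.move[OF s] rauzy_step.e_cases[OF s] rauzy_step.distinct_levels[OF s] by auto
  show ?thesis
    using m(2) move_prefix[OF m(1,3), of "\<lambda>x. base x \<notin> active"] assms by auto
qed

lemma pre_length: "length (pre n 0) + length (pre n 1) \<le> CARD('a letter)"
proof -
  have le: "length (pre n i) \<le> length (table_row (P n) i)" for i
    unfolding prefix_until_def by (metis length_dropWhile_le length_rev)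
  have "length (table_row (P n) 0) + length (table_row (P n) 1) = card (set (fst (P n) @ snd (P n)))"
    unfolding distinct_card[OF stage.distinct_letters[of n]] by (simp add: table_row_def)
  also have "\<dots> = CARD('a letter)" unfolding stage.all_letters ..
  finally show ?thesis using le[of 0] le[of 1] by simp
qed

text \<open>
  The total length of the two prefixes never decreases and is bounded, so it is eventually constant.
  From then on no winner or inverse of a winner belongs to a prefix. As every active letter still
  has to win, the prefixes consist of inactive letters.
\<close>

lemma pre_stable:
  obtains N where "\<And>n. n \<ge> N \<Longrightarrow> base (W n) \<in> active \<and> base (V n) \<in> active"
    "\<And>n i. n \<ge> N \<Longrightarrow> i = 0 \<or> i = 1 \<Longrightarrow> pre n i = pre N i"
    "\<And>x i. i = 0 \<or> i = 1 \<Longrightarrow> x \<in> set (pre N i) \<Longrightarrow> base x \<notin> active"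
proof -
  obtain M where M: "\<And>n. n \<ge> M \<Longrightarrow> base (W n) \<in> active \<and> base (V n) \<in> active"
    using eventually_active by blast
  define f where "f k = length (pre (M + k) 0) + length (pre (M + k) 1)" for k
  have up: "f k \<le> f (Suc k)" for k
    using pre_step[of "M + k"] M[of "M + k"] by (auto simp: f_def)
  have "range f \<subseteq> {..CARD('a letter)}" using pre_length by (auto simp: f_def)
  then have fin: "finite (range f)" using finite_subset by blast
  then have "Max (range f) \<in> range f" by (rule Max_in) simp
  then obtain K where K: "f K = Max (range f)" by auto
  have const: "f k = f K" if "k \<ge> K" for k
    using lift_Suc_mono_le[of f, OF up that] Max_ge[OF fin, of "f k"] K by simp
  define N where "N = M + K"
  have stay: "pre (Suc n) i = pre n i \<and> W n \<notin> set (pre n i) \<and> inv_letter (W n) \<notin> set (pre n i)"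
    if n: "n \<ge> N" and i: "i = 0 \<or> i = 1" for n i
  proof -
    have "n = M + (n - M)" "n - M \<ge> K" "Suc n = M + Suc (n - M)" "Suc (n - M) \<ge> K" using n by (auto simp: N_def)
    then have "length (pre n 0) + length (pre n 1) = length (pre (Suc n) 0) + length (pre (Suc n) 1)"
      using const[of "n - M"] const[of "Suc (n - M)"] by (simp add: f_def)
    then show ?thesis using pre_step[of n] M[of n] n i by (auto simp: N_def)
  qed
  have pre: "pre n i = pre N i" if "n \<ge> N" "i = 0 \<or> i = 1" for n i
    using that(1) by (induction n rule: dec_induct) (use stay that(2) in auto)
  show ?thesis
  proof
    show "base (W n) \<in> active \<and> base (V n) \<in> active" if "n \<ge> N" for n using M that by (simp add: N_def)
    show "pre n i = pre N i" if "n \<ge> N" "i = 0 \<or> i = 1" for n i using pre that .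
    show "base x \<notin> active" if i: "i = 0 \<or> i = 1" and x: "x \<in> set (pre N i)" for x i
    proof
      assume "base x \<in> active"
      then obtain n where n: "n \<ge> N" "base (W n) = base x" by (auto simp: active_def INFM_nat_le)
      then have "x = W n \<or> x = inv_letter (W n)" using base_eq_iff[of x "W n"] by simp
      then show False using stay[OF n(1) i] pre[OF n(1) i] x by auto
    qed
  qed
qed

lemma last_letters:
  assumes "i = 0 \<or> i = 1"
  shows "table_row (P n) i \<noteq> [] \<and> last (table_row (P n) i) \<in> {W n, V n}"
proof -
  obtain e where s: "rauzy_step (P n) (\<Lambda> n) (P (Suc n)) e (W n) (V n)" using steps by blast
  have "i = e \<or> i = 1 - e" using rauzy_step.e_cases[OF s] assms by auto
  then show ?thesis using rauzy_move_lasts[OF rauzy_step.move[OF s] rauzy_step.e_cases[OF s]] by auto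
qed

text \<open>
  Two initial segments of the same length, proper and nonempty, give a connection of length \<open>0\<close>.
\<close>

lemma no_common_cut:
  assumes r: "table_row (P n) 0 = u @ x # u'" "table_row (P n) 1 = v @ y # v'" and "u \<noteq> []"
    and eq: "word_len (\<Lambda> n) u = word_len (\<Lambda> n) v"
  shows False
proof -
  have x: "row_of (P n) x = 0" "left_end (P n) (\<Lambda> n) x = word_len (\<Lambda> n) u"
    and y: "row_of (P n) y = 1" "left_end (P n) (\<Lambda> n) y = word_len (\<Lambda> n) v"
    using stage.left_end_eq[of 0 n u x u'] stage.left_end_eq[of 1 n v y v'] r by auto
  have pos: "0 < word_len (\<Lambda> n) u" using word_len_pos[OF stage.len_pos \<open>u \<noteq> []\<close>] .
  have "(word_len (\<Lambda> n) u, 0) \<in> sing (P n) (\<Lambda> n)"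
    unfolding stage.mem_sing by (rule exI[of _ x]) (simp add: x pos)
  moreover have "(word_len (\<Lambda> n) u, 1) \<in> sing (P n) (\<Lambda> n)"
    unfolding stage.mem_sing by (rule exI[of _ y]) (use y pos eq in simp)
  moreover have "sigma2 (word_len (\<Lambda> n) u, 0) = (word_len (\<Lambda> n) u, 1)" by (simp add: sigma2_def)
  moreover have "((word_len (\<Lambda> n) u, 1), (word_len (\<Lambda> n) u, 1)) \<in> linv_graph (P n) (\<Lambda> n) ^^ 0" by simp
  ultimately show False using keane_all[of n] unfolding keane_def by (metis image_eqI)
qed

lemma active_sum_tendsto: "(\<lambda>n. \<Sum>x | base x \<in> active. \<Lambda> n (base x)) \<longlonglongrightarrow> 0"
  using tendsto_sum[of "{x. base x \<in> active}" "\<lambda>x n. \<Lambda> n (base x)" "\<lambda>_. 0" sequentially]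
    active_tendsto by simp

lemma word_len_active:
  assumes "distinct u" "\<And>x. x \<in> set u \<Longrightarrow> base x \<in> active"
  shows "word_len (\<Lambda> n) u \<le> (\<Sum>x | base x \<in> active. \<Lambda> n (base x))"
  unfolding word_len_distinct[OF assms(1)]
proof (rule sum_mono2)
  have "finite (UNIV :: 'a letter set)" using stage.all_letters[of 0] by (metis List.finite_set)
  then show "finite {x :: 'a letter. base x \<in> active}" by (rule rev_finite_subset) simp
qed (use assms(2) stage.len_nonneg in auto)

text \<open>
  If there were inactive letters, the stable prefixes of both rows would be nonempty and have the same
  length, and they would be proper because the last letters of the rows are active.
\<close>

lemma all_active: "active = UNIV"
proof (rule ccontr)
  assume "active \<noteq> UNIV"
  then obtain a where a: "a \<notin> active" by auto
  obtain N where act: "\<And>n. n \<ge> N \<Longrightarrow> base (W n) \<in> active \<and> base (V n) \<in> active"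
    and stable: "\<And>n i. n \<ge> N \<Longrightarrow> i = 0 \<or> i = 1 \<Longrightarrow> pre n i = pre N i"
    and inactive: "\<And>x i. i = 0 \<or> i = 1 \<Longrightarrow> x \<in> set (pre N i) \<Longrightarrow> base x \<notin> active"
    by (rule pre_stable) blast
  \<comment> \<open>The lengths of the two inactive blocks. They do not depend on the stage, and both rows
    exceed them by lengths of active letters only.\<close>
  define c where "c i = word_len (\<Lambda> N) (pre N i)" for i
  have fixed: "\<Lambda> n b = \<Lambda> N b" if "n \<ge> N" "b \<notin> active" for n b
    using that(1)
  proof (induction n rule: dec_induct)
    case (step n)
    then show ?case using act[of n] that(2) by (auto simp: lengths)
  qed simp
  let ?D = "\<lambda>n. \<Sum>x | base x \<in> active. \<Lambda> n (base x)"
  have rest: "word_len (\<Lambda> n) (fst (P n)) - c i \<in> {0..?D n}" if n: "n \<ge> N" and i: "i = 0 \<or> i = 1" for n i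
  proof -
    obtain v where v: "table_row (P n) i = pre N i @ v" "\<forall>x\<in>set v. base x \<in> active"
      using prefix_until_split[of "table_row (P n) i" "\<lambda>x. base x \<notin> active"] stable[OF n i] by auto
    have "word_len (\<Lambda> n) (pre N i) = c i"
      unfolding c_def by (rule word_len_cong) (use fixed[OF n] inactive[OF i] in auto)
    then have "word_len (\<Lambda> n) (fst (P n)) = c i + word_len (\<Lambda> n) v"
      using stage.word_len_row[of n i] v(1) by simp
    moreover have "distinct v" using stage.distinct_row[of n i] v(1) by simp
    ultimately show ?thesis using word_len_active[of v n] v(2) word_len_nonneg[of "\<Lambda> n" v, OF stage.len_pos] by auto
  qed
  have "\<bar>c 0 - c 1\<bar> \<le> ?D n" if "n \<ge> N" for n
    using rest[OF that, of 0] rest[OF that, of 1] by auto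
  then have "\<bar>c 0 - c 1\<bar> \<le> 0"
    using LIMSEQ_le_const[OF active_sum_tendsto] by blast
  then have c: "c 0 = c 1" by simp
  have decomp: "\<exists>y v. table_row (P N) i = pre N i @ y # v" if i: "i = 0 \<or> i = 1" for i
  proof -
    obtain v where v: "table_row (P N) i = pre N i @ v"
      using prefix_until_split[of "table_row (P N) i" "\<lambda>x. base x \<notin> active"] by auto
    have "v \<noteq> []"
    proof
      assume "v = []"
      then have "last (table_row (P N) i) \<in> set (pre N i)" using v last_letters[OF i, of N] by (metis append_Nil2 last_in_set)
      then show False using inactive[OF i] last_letters[OF i, of N] act[of N] by auto
    qed
    then show ?thesis using v by (metis neq_Nil_conv)
  qed
  define i where "i = row_of (P N) (Pos a)"
  have i: "i = 0 \<or> i = 1" "Pos a \<in> set (table_row (P N) i)"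
    using stage.row_cases[of N "Pos a"] stage.mem_row[of i "Pos a" N] by (auto simp: i_def)
  obtain v where v: "table_row (P N) i = pre N i @ v" "\<forall>x\<in>set v. base x \<in> active"
    using prefix_until_split[of "table_row (P N) i" "\<lambda>x. base x \<notin> active"] by auto
  have "Pos a \<notin> set v" using v(2) a by auto
  moreover have "Pos a \<in> set (pre N i @ v)" using i(2) unfolding v(1)[symmetric] .
  ultimately have "pre N i \<noteq> []" by auto
  then have "c i > 0" unfolding c_def by (rule word_len_pos[OF stage.len_pos])
  then have "c 0 > 0" using i(1) c by auto
  then have "pre N 0 \<noteq> []" by (auto simp: c_def)
  moreover obtain y v y' v' where "table_row (P N) 0 = pre N 0 @ y # v" "table_row (P N) 1 = pre N 1 @ y' # v'"
    using decomp[of 0] decomp[of 1] by auto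
  ultimately show False using no_common_cut[of N "pre N 0" y v "pre N 1" y' v'] c by (simp add: c_def)
qed

theorem widths_tendsto_0: "(\<lambda>n. word_len (\<Lambda> n) (fst (P n))) \<longlonglongrightarrow> 0"
proof (rule tendsto_sandwich[OF _ _ tendsto_const active_sum_tendsto])
  show "\<forall>\<^sub>F n in sequentially. 0 \<le> word_len (\<Lambda> n) (fst (P n))"
    by (intro always_eventually allI word_len_nonneg stage.len_pos)
  have "distinct (fst (P n))" for n using stage.distinct_letters[of n] by simp
  then show "\<forall>\<^sub>F n in sequentially. word_len (\<Lambda> n) (fst (P n)) \<le> (\<Sum>x | base x \<in> active. \<Lambda> n (base x))"
    using word_len_active by (simp add: all_active)
qed

end

section \<open>Itineraries and the two inclusions\<close>

context linear_involution begin

lemma regular_funpow: "z \<in> R \<Longrightarrow> (T ^^ n) z \<in> R"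
  by (induction n) (simp_all add: regular_linv)

lemma linv_power_Suc:
  assumes "z \<in> R"
  shows "linv_power p len k z \<in> R \<and> linv_power p len (k + 1) z = T (linv_power p len k z)"
proof (cases "k \<ge> 0")
  case True
  then have "nat (k + 1) = Suc (nat k)" by simp
  then show ?thesis using True regular_funpow[OF assms] by (simp add: linv_power_def)
next
  case False
  define n where "n = nat (- k) - 1"
  have k: "nat (- k) = Suc n" "nat (- (k + 1)) = n" using False by (auto simp: n_def)
  let ?g = "inv_into R T"
  have inverse: "?g y \<in> R \<and> T (?g y) = y" if "y \<in> R" for y
    using that inv_into_into[of y T R] f_inv_into_f[of y T R] unfolding image_regular by blast
  have pow: "(?g ^^ m) z \<in> R" for m
    by (induction m) (use assms inverse in auto)
  have "linv_power p len k z = ?g ((?g ^^ n) z)" using False k by (simp add: linv_power_def)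
  moreover have "linv_power p len (k + 1) z = (?g ^^ n) z"
    using False k by (cases "k = -1") (auto simp: linv_power_def)
  ultimately show ?thesis using inverse[OF pow] by simp
qed

lemma linv_power_add:
  assumes "z \<in> R" shows "linv_power p len (k + int n) z = (T ^^ n) (linv_power p len k z)"
proof (induction n)
  case (Suc n)
  have "linv_power p len (k + int (Suc n)) z = linv_power p len ((k + int n) + 1) z"
    by (simp add: algebra_simps)
  then show ?case using linv_power_Suc[OF assms, of "k + int n"] Suc by simp
qed simp

lemma linv_funpow_inj: "y \<in> R \<Longrightarrow> z \<in> R \<Longrightarrow> (T ^^ n) y = (T ^^ n) z \<Longrightarrow> y = z"
proof (induction n)
  case (Suc n)
  have "T ((T ^^ n) y) = T ((T ^^ n) z)" using Suc.prems(3) by simp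
  then have "(T ^^ n) y = (T ^^ n) z"
    using inj_onD[OF linv_inj_regular] regular_funpow Suc.prems(1,2) by blast
  then show ?case using Suc by blast
qed simp

lemma linv_power_surj:
  assumes z: "z \<in> R" shows "\<exists>y\<in>R. linv_power p len k y = z"
proof (cases "k \<ge> 0")
  case True
  let ?y = "linv_power p len (- k) z"
  have y: "?y \<in> R" using linv_power_Suc[OF z] by blast
  have "(T ^^ nat k) ?y = linv_power p len (- k + int (nat k)) z"
    by (rule linv_power_add[OF z, symmetric])
  also have "\<dots> = z" using True by (simp add: linv_power_def)
  finally show ?thesis using y True by (auto simp: linv_power_def)
next
  case False
  let ?y = "(T ^^ nat (- k)) z"
  have y: "?y \<in> R" by (rule regular_funpow[OF z])
  have "(T ^^ nat (- k)) (linv_power p len k ?y) = linv_power p len (k + int (nat (- k))) ?y"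
    by (rule linv_power_add[OF y, symmetric])
  also have "\<dots> = ?y" using False by (simp add: linv_power_def)
  finally have "linv_power p len k ?y = z"
    using linv_funpow_inj[of "linv_power p len k ?y" z] linv_power_Suc[OF y, of k] z by blast
  then show ?thesis using y by blast
qed

lemma ex_regular_between:
  assumes "a < b" "\<And>t. a < t \<Longrightarrow> t < b \<Longrightarrow> (t, e) \<in> double_interval p len"
  shows "\<exists>t. a < t \<and> t < b \<and> (t, e) \<in> R"
proof (rule ccontr)
  assume *: "\<not> ?thesis"
  let ?bad = "fst ` (orb \<union> sigma2 ` orb)"
  have "{a <..< b} \<subseteq> ?bad"
  proof
    fix t assume "t \<in> {a <..< b}"
    then have "(t, e) \<in> orb \<union> sigma2 ` orb"
      using * assms(2) by (auto simp: regular_points_def)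
    then show "t \<in> ?bad" by (rule image_eqI[rotated]) simp
  qed
  moreover have "countable ?bad" using countable_sing_orbits by auto
  ultimately have "countable {a <..< b}" by (rule countable_subset)
  then show False using uncountable_open_interval[of a b] assms(1) by simp
qed

text \<open>
  The set whose closure is the natural coding, in the form in which the latter is defined.
\<close>

definition itineraries :: "(int \<Rightarrow> 'a letter) set" where
  "itineraries = {\<omega>. \<exists>z \<in> R. \<forall>n x. \<omega> n = x \<longleftrightarrow> linv_power p len n z \<in> J x}"

lemma itinerary_ex:
  assumes z: "z \<in> R" shows "\<exists>\<omega>\<in>itineraries. \<forall>n. linv_power p len n z \<in> J (\<omega> n)"
proof -
  define \<omega> where "\<omega> n = (SOME x. linv_power p len n z \<in> J x)" for n
  have \<omega>: "linv_power p len n z \<in> J (\<omega> n)" for n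
    unfolding \<omega>_def by (rule someI_ex[OF regular_piece[OF conjunct1[OF linv_power_Suc[OF z]]]])
  have "\<omega> n = x \<longleftrightarrow> linv_power p len n z \<in> J x" for n x
    using \<omega>[of n] piece_unique[OF \<omega>[of n], of x] by auto
  then have "\<omega> \<in> itineraries" unfolding itineraries_def by (intro CollectI bexI[OF _ z] allI)
  then show ?thesis using \<omega> by (intro bexI[of _ \<omega>] allI)
qed

end

text \<open>
  Cylinders on finite windows form a basis of the product of discrete topologies.
\<close>

lemma closure_of_sequences:
  fixes C :: "(int \<Rightarrow> 'b) set"
  shows "\<omega> \<in> product_topology (\<lambda>_. discrete_topology UNIV) UNIV closure_of C \<longleftrightarrow>
    (\<forall>k l. \<exists>\<omega>'\<in>C. \<forall>n\<in>{k..l}. \<omega>' n = \<omega> n)" (is "\<omega> \<in> ?X closure_of C \<longleftrightarrow> ?rhs")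
proof
  assume \<omega>: "\<omega> \<in> ?X closure_of C"
  show ?rhs
  proof (intro allI)
    fix k l :: int
    define B where "B = (\<Pi>\<^sub>E n\<in>UNIV. if n \<in> {k..l} then {\<omega> n} else UNIV)"
    have "openin ?X B" unfolding B_def
      by (rule product_topology_basis) (auto intro: finite_subset[of _ "{k..l}"])
    moreover have "\<omega> \<in> B" by (auto simp: B_def)
    ultimately obtain \<omega>' where \<omega>': "\<omega>' \<in> C" "\<omega>' \<in> B" using \<omega> by (auto simp: in_closure_of)
    have "\<omega>' n = \<omega> n" if "n \<in> {k..l}" for n
      using PiE_mem[OF \<omega>'(2)[unfolded B_def] UNIV_I, of n] that by simp
    with \<omega>'(1) show "\<exists>\<omega>'\<in>C. \<forall>n\<in>{k..l}. \<omega>' n = \<omega> n" by blast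
  qed
next
  assume rhs: ?rhs
  show "\<omega> \<in> ?X closure_of C"
    unfolding in_closure_of
  proof (intro conjI allI impI)
    show "\<omega> \<in> topspace ?X" by simp
    fix B assume "\<omega> \<in> B \<and> openin ?X B"
    then obtain U where U: "finite {n. U n \<noteq> UNIV}" "\<omega> \<in> (\<Pi>\<^sub>E n\<in>UNIV. U n)" "(\<Pi>\<^sub>E n\<in>UNIV. U n) \<subseteq> B"
      unfolding openin_product_topology_alt by fastforce
    obtain k l where kl: "{n. U n \<noteq> UNIV} \<subseteq> {k..l}"
    proof (cases "{n. U n \<noteq> UNIV} = {}")
      case False
      show ?thesis
      proof (rule that[of "Min {n. U n \<noteq> UNIV}" "Max {n. U n \<noteq> UNIV}"], rule subsetI)
        fix n assume "n \<in> {n. U n \<noteq> UNIV}"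
        then show "n \<in> {Min {n. U n \<noteq> UNIV}..Max {n. U n \<noteq> UNIV}}"
          using Min_le[OF U(1), of n] Max_ge[OF U(1), of n] by simp
      qed
    qed (use that in blast)
    obtain \<omega>' where \<omega>': "\<omega>' \<in> C" "\<And>n. n \<in> {k..l} \<Longrightarrow> \<omega>' n = \<omega> n" using rhs by blast
    have "\<omega>' n \<in> U n" for n
    proof (cases "U n = UNIV")
      case False
      then show ?thesis using kl \<omega>'(2)[of n] U(2) by (auto simp: PiE_iff)
    qed simp
    then have "\<omega>' \<in> B" using U(3) by auto
    then show "\<exists>y. y \<in> C \<and> y \<in> B" using \<omega>'(1) by blast
  qed
qed

context finite_rauzy_sequence begin

abbreviation "itin \<equiv> linear_involution.itineraries (P 0) (\<Lambda> 0)"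

text \<open>
  The points of a finite orbit segment have positive coordinates, so a short enough interval
  contains none of them. A positive \<open>N\<close> is asked for by the definition of the subshift.
\<close>

lemma ex_stage_avoiding:
  assumes "\<And>i. i < m \<Longrightarrow> (TT 0 ^^ i) z \<in> RR 0"
  shows "\<exists>N>0. \<forall>i<m. (TT 0 ^^ i) z \<notin> RR N"
proof -
  have "\<forall>i. \<exists>M. i < m \<longrightarrow> (\<forall>N\<ge>M. word_len (\<Lambda> N) (fst (P N)) < fst ((TT 0 ^^ i) z))"
  proof
    fix i
    show "\<exists>M. i < m \<longrightarrow> (\<forall>N\<ge>M. word_len (\<Lambda> N) (fst (P N)) < fst ((TT 0 ^^ i) z))"
    proof (cases "i < m")
      case True
      then have "0 < fst ((TT 0 ^^ i) z)"
        using assms[of i] by (simp add: stage.regular_iff stage.mem_double_interval)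
      from order_tendstoD(2)[OF widths_tendsto_0 this] show ?thesis
        by (auto simp: eventually_sequentially)
    qed simp
  qed
  then obtain M where M: "\<And>i N. i < m \<Longrightarrow> M i \<le> N \<Longrightarrow> word_len (\<Lambda> N) (fst (P N)) < fst ((TT 0 ^^ i) z)"
    by metis
  define N where "N = Suc (Max (M ` {..<m}))"
  have "M i \<le> N" if "i < m" for i
  proof -
    have "M i \<le> Max (M ` {..<m})" using that by (intro Max_ge) auto
    then show ?thesis by (simp add: N_def)
  qed
  then have "word_len (\<Lambda> N) (fst (P N)) < fst ((TT 0 ^^ i) z)" if "i < m" for i using M[OF that] that by blast
  then have "(TT 0 ^^ i) z \<notin> RR N" if "i < m" for i
    using that by (auto simp: stage.regular_iff stage.mem_double_interval dest: less_asym)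
  then show ?thesis by (intro exI[of _ N]) (simp add: N_def)
qed

lemma itinerary_word_in_sadic:
  assumes \<omega>: "\<omega> \<in> itin" and kl: "k \<le> l"
  shows "\<exists>x N. 0 < N \<and> sublist (map \<omega> [k..l]) (U N [x])"
proof -
  obtain z where z: "z \<in> RR 0" "\<And>n. linv_power (P 0) (\<Lambda> 0) n z \<in> piece (P 0) (\<Lambda> 0) (\<omega> n)"
    using \<omega> unfolding stage.itineraries_def by blast
  define y where "y = linv_power (P 0) (\<Lambda> 0) k z"
  have y: "y \<in> RR 0" using stage.linv_power_Suc[OF z(1)] by (simp add: y_def)
  let ?u = "map \<omega> [k..l]"
  have orbit: "(TT 0 ^^ i) y \<in> piece (P 0) (\<Lambda> 0) (?u ! i)" if "i < length ?u" for i
    using that z(2)[of "k + int i"] stage.linv_power_add[OF z(1), of k i] by (simp add: y_def)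
  obtain N where N: "N > 0" "\<And>i. i < length ?u \<Longrightarrow> (TT 0 ^^ i) y \<notin> RR N"
    using ex_stage_avoiding[of "length ?u" y] stage.regular_funpow[OF y] by blast
  have "?u \<noteq> []" using kl by simp
  then show ?thesis using coding_in_return_word[OF y orbit N(2)] N(1) by blast
qed

text \<open>
  The word is read along the orbit of every point of the piece \<open>x\<close> at stage \<open>N\<close>. Regularity at
  stage \<open>0\<close> is needed, so the point is chosen outside of the countable set of singular orbits, and its
  orbit is then shifted to put the word at the window from \<open>k\<close> to \<open>l\<close>.
\<close>

lemma sadic_word_in_itinerary:
  assumes "sublist (map \<omega> [k..l]) (U N [x])"
  shows "\<exists>\<omega>'\<in>itin. \<forall>n\<in>{k..l}. \<omega>' n = \<omega> n"
proof -
  obtain us vs where u: "U N [x] = us @ map \<omega> [k..l] @ vs" using assms by (auto simp: sublist_def)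
  let ?J = "piece (P 0) (\<Lambda> 0)"
  let ?a = "left_end (P N) (\<Lambda> N) x"
  let ?e = "row_of (P N) x"
  have coded: "codes (P 0) (\<Lambda> 0) y (U N [x]) \<and> 0 < length (U N [x])"
    if "y \<in> piece (P N) (\<Lambda> N) x" for y
    using codes_compose[of N y "[x]"] that by auto
  have "(t, ?e) \<in> double_interval (P 0) (\<Lambda> 0)" if "?a < t" "t < ?a + \<Lambda> N (base x)" for t
  proof -
    have "(t, ?e) \<in> piece (P N) (\<Lambda> N) x" using that by (simp add: stage.mem_piece)
    then have "(t, ?e) \<in> ?J (U N [x] ! 0)" using coded codes_nth[of "P 0" "\<Lambda> 0" "(t, ?e)" "U N [x]" 0] by simp
    then show ?thesis by (rule stage.piece_interval)
  qed
  then obtain t where t: "?a < t" "t < ?a + \<Lambda> N (base x)" "(t, ?e) \<in> RR 0"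
    using stage.ex_regular_between[of ?a "?a + \<Lambda> N (base x)" ?e 0] stage.len_pos[of N "base x"] by auto
  let ?y = "(t, ?e)"
  have y: "codes (P 0) (\<Lambda> 0) ?y (U N [x])" using coded[of ?y] t by (simp add: stage.mem_piece)
  define z where "z = (TT 0 ^^ length us) ?y"
  have "z \<in> RR 0" unfolding z_def by (rule stage.regular_funpow[OF t(3)])
  then obtain z0 where z0: "z0 \<in> RR 0" "linv_power (P 0) (\<Lambda> 0) k z0 = z" using stage.linv_power_surj by blast
  obtain \<omega>' where \<omega>': "\<omega>' \<in> itin" "\<And>n. linv_power (P 0) (\<Lambda> 0) n z0 \<in> ?J (\<omega>' n)"
    using stage.itinerary_ex[OF z0(1)] by blast
  have "\<omega>' n = \<omega> n" if n: "n \<in> {k..l}" for n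
  proof -
    define i where "i = nat (n - k)"
    have i: "n = k + int i" "i < length (map \<omega> [k..l])" using n by (auto simp: i_def)
    have "(TT 0 ^^ i) z \<in> ?J (\<omega>' n)"
      using \<omega>'(2)[of n] stage.linv_power_add[OF z0(1), of k i] z0(2) i(1) by simp
    moreover have "(TT 0 ^^ (i + length us)) ?y \<in> ?J (U N [x] ! (i + length us))"
      by (rule codes_nth[OF y]) (use i(2) u in simp)
    then have "(TT 0 ^^ i) z \<in> ?J (map \<omega> [k..l] ! i)"
      unfolding z_def funpow_add_apply using i(2) by (simp add: u nth_append)
    then have "(TT 0 ^^ i) z \<in> ?J (\<omega> n)" using i n by simp
    ultimately show ?thesis by (rule stage.piece_unique)
  qed
  then show ?thesis using \<omega>'(1) by blast
qed

theorem coding_eq_sadic: "natural_coding (P 0) (\<Lambda> 0) = sadic_subshift \<tau>"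
proof (rule Set.set_eqI)
  fix \<omega> :: "int \<Rightarrow> 'a letter"
  have "\<omega> \<in> natural_coding (P 0) (\<Lambda> 0) \<longleftrightarrow> (\<forall>k l. \<exists>\<omega>'\<in>itin. \<forall>n\<in>{k..l}. \<omega>' n = \<omega> n)"
    unfolding natural_coding_def stage.itineraries_def[symmetric] by (rule closure_of_sequences)
  also have "\<dots> \<longleftrightarrow> \<omega> \<in> sadic_subshift \<tau>"
  proof
    assume approx: "\<forall>k l. \<exists>\<omega>'\<in>itin. \<forall>n\<in>{k..l}. \<omega>' n = \<omega> n"
    have "\<exists>x N. 0 < N \<and> sublist (map \<omega> [k..l]) (U N [x])" if "k \<le> l" for k l
    proof -
      obtain \<omega>' where \<omega>': "\<omega>' \<in> itin" "\<forall>n\<in>{k..l}. \<omega>' n = \<omega> n" using approx by blast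
      have "map \<omega> [k..l] = map \<omega>' [k..l]" using \<omega>'(2) by simp
      from itinerary_word_in_sadic[OF \<omega>'(1) that, folded this] show ?thesis .
    qed
    then show "\<omega> \<in> sadic_subshift \<tau>" by (simp add: sadic_subshift_def)
  next
    assume \<omega>: "\<omega> \<in> sadic_subshift \<tau>"
    show "\<forall>k l. \<exists>\<omega>'\<in>itin. \<forall>n\<in>{k..l}. \<omega>' n = \<omega> n"
    proof (intro allI)
      fix k l :: int
      have "k \<le> max k l" by simp
      then obtain x N where "sublist (map \<omega> [k..max k l]) (U N [x])"
        using \<omega> unfolding sadic_subshift_def by blast
      from sadic_word_in_itinerary[OF this] obtain \<omega>'
        where \<omega>': "\<omega>' \<in> itin" "\<forall>n\<in>{k..max k l}. \<omega>' n = \<omega> n" ..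
      have "\<forall>n\<in>{k..l}. \<omega>' n = \<omega> n" using \<omega>'(2) by simp
      then show "\<exists>\<omega>'\<in>itin. \<forall>n\<in>{k..l}. \<omega>' n = \<omega> n" using \<omega>'(1) by (rule bexI)
    qed
  qed
  finally show "\<omega> \<in> natural_coding (P 0) (\<Lambda> 0) \<longleftrightarrow> \<omega> \<in> sadic_subshift \<tau>" .
qed

end

text \<open>
  Starting from \<open>(p, len)\<close>, each stage is again a linear involution with the Keane property, so the induction never
  stops, and its stages form a sequence to which the preceding results apply.
\<close>

theorem theorem3p2:
  fixes \<pi> :: "'a::finite table"
    and p :: "'a letter table"
    and len :: "'a \<Rightarrow> real"
  assumes "CARD('a) \<ge> 2"
    and "generalized_permutation \<pi>"
    and "labelled_version p \<pi>"
    and "admissible \<pi> len"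
    and "keane p len"
  shows "natural_coding p len = sadic_subshift (rv_directive_sequence (p, len))"
proof -
  have base_sum: "word_len len u = (\<Sum>a\<leftarrow>map base u. len a)" for u
    by (simp add: word_len_def comp_def)
  have widths: "word_len len (fst p) = (\<Sum>a\<leftarrow>fst \<pi>. len a)" "word_len len (snd p) = (\<Sum>a\<leftarrow>snd \<pi>. len a)"
    unfolding base_sum using assms(3) by (simp_all only: labelled_version_def)
  have start: "linear_involution p len"
    using assms(3,4) widths by unfold_locales (auto simp: labelled_version_def admissible_def)
  define s where "s n = the (rv_iter n (p, len))" for n
  have step: "\<exists>q e. rv (s n) = Some (q, (snd (s n))(base (winner (s n)) :=
        snd (s n) (base (winner (s n))) - snd (s n) (base (loser (s n))))) \<and>
      rauzy_step (fst (s n)) (snd (s n)) q e (winner (s n)) (loser (s n))"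
    if "linear_involution (fst (s n)) (snd (s n))" "keane (fst (s n)) (snd (s n))" for n
    using linear_involution.rv_step[OF that(1) assms(1) that(2)] by simp
  have iter: "rv_iter n (p, len) = Some (s n) \<and> linear_involution (fst (s n)) (snd (s n)) \<and>
    keane (fst (s n)) (snd (s n))" for n
  proof (induction n)
    case 0
    then show ?case using start assms(5) by (simp add: s_def)
  next
    case (Suc n)
    then obtain q e where q: "rv (s n) = Some (q, (snd (s n))(base (winner (s n)) :=
        snd (s n) (base (winner (s n))) - snd (s n) (base (loser (s n)))))"
      and r: "rauzy_step (fst (s n)) (snd (s n)) q e (winner (s n)) (loser (s n))"
      using step by blast
    have "rv_iter (Suc n) (p, len) = rv (s n)" using Suc by simp
    then have iter: "rv_iter (Suc n) (p, len) = Some (s (Suc n))" using q by (simp add: s_def)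
    then have "s (Suc n) = (q, (snd (s n))(base (winner (s n)) :=
        snd (s n) (base (winner (s n))) - snd (s n) (base (loser (s n)))))"
      using \<open>rv_iter (Suc n) (p, len) = rv (s n)\<close> q by (metis option.inject)
    then have fst_s: "fst (s (Suc n)) = q" and snd_s: "snd (s (Suc n)) = (snd (s n))(base (winner (s n)) :=
        snd (s n) (base (winner (s n))) - snd (s n) (base (loser (s n))))"
      by (simp_all only: prod.sel)
    have "keane (fst (s n)) (snd (s n))" using Suc by blast
    then show ?case unfolding fst_s snd_s
      using iter rauzy_step.new_involution[OF r] rauzy_step.new_keane[OF r] by blast
  qed
  have rv: "rv (s n) = Some (s (Suc n))" for n using iter[of n] iter[of "Suc n"] by simp
  interpret finite_rauzy_sequence "\<lambda>n. fst (s n)" "\<lambda>n. snd (s n)" "\<lambda>n. winner (s n)" "\<lambda>n. loser (s n)"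
  proof
    fix n
    obtain q e where q: "rv (s n) = Some (q, (snd (s n))(base (winner (s n)) :=
        snd (s n) (base (winner (s n))) - snd (s n) (base (loser (s n)))))"
      and r: "rauzy_step (fst (s n)) (snd (s n)) q e (winner (s n)) (loser (s n))"
      using step iter by blast
    then have s: "s (Suc n) = (q, (snd (s n))(base (winner (s n)) :=
        snd (s n) (base (winner (s n))) - snd (s n) (base (loser (s n)))))" using rv by simp
    show "\<exists>e. rauzy_step (fst (s n)) (snd (s n)) (fst (s (Suc n))) e (winner (s n)) (loser (s n))"
      using r s by auto
    show "snd (s (Suc n)) = (snd (s n))(base (winner (s n)) :=
        snd (s n) (base (winner (s n))) - snd (s n) (base (loser (s n))))"
      using s by simp
    show "keane (fst (s n)) (snd (s n))" using iter by blast
  qed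
  have "rv_directive_sequence (p, len) = (\<lambda>n. rv_morphism (winner (s n)) (loser (s n)))"
    by (simp add: rv_directive_sequence_def rv_winner_def rv_loser_def s_def fun_eq_iff)
  moreover have "s 0 = (p, len)" by (simp add: s_def)
  ultimately show ?thesis using coding_eq_sadic by simp
qed

end
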